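(* Let $n>1$, let $K\subset\mathbb{R}^n$ be a closed (compact) convex centrally symmetric body of positive measure, and let $\Lambda\subset\mathbb{R}^n$ be a set such that $$\Lambda+\rho K^o=\mathbb{R}^n\quad\text{for some } 0<\rho<\frac{\pi}{2}.$$ Then $$\sup_{t\in\mathbb{R}^n}|f(t)|\le\frac{1}{\cos\rho}\,\sup_{\lambda\in\Lambda}|f(\lambda)|\quad\text{for every } f\in B_K,$$ and so $\Lambda$ is a stable sampling set for $B_K$.
   Context: $K^o=\{x\in\mathbb{R}^n: x\cdot y\le 1 \text{ for all } y\in K\}$ is the polar body of $K$. For a compact set $K\subset\mathbb{R}^n$, the Bernstein space $B_K$ consists of all continuous bounded functions on $\mathbb{R}^n$ that are Fourier transforms of (tempered) distributions supported by $K$, with the sup norm. $\Lambda$ is a stable sampling set for $B_K$ if there is a constant $C$ with $\sup_{\mathbb{R}^n}|f|\le C\sup_{\lambda\in\Lambda}|f(\lambda)|$ for all $f\in B_K$. *)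

theory Defs
  imports "HOL-Analysis.Analysis"
begin

definition partial_deriv :: "'n::finite \<Rightarrow> (real^'n \<Rightarrow> complex) \<Rightarrow> real^'n \<Rightarrow> complex" where
  "partial_deriv i f x = frechet_derivative f (at x) (axis i 1)"

definition partial_derivs :: "'n::finite list \<Rightarrow> (real^'n \<Rightarrow> complex) \<Rightarrow> real^'n \<Rightarrow> complex" where
  "partial_derivs \<beta> f = foldr partial_deriv \<beta> f"

(* Multi-indices are lists of coordinate directions. Requiring every iterated partial
   derivative to be totally differentiable is the same as f being C^infinity. *)
definition smooth_fun :: "(real^'n::finite \<Rightarrow> complex) \<Rightarrow> bool" where
  "smooth_fun f \<longleftrightarrow> (\<forall>\<beta> x. partial_derivs \<beta> f differentiable (at x))"

definition schwartz_space :: "(real^'n::finite \<Rightarrow> complex) set" where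
  "schwartz_space = {\<phi>. smooth_fun \<phi> \<and>
     (\<forall>N \<beta>. bounded (range (\<lambda>x. (1 + norm x) ^ N *\<^sub>R partial_derivs \<beta> \<phi> x)))}"

(* This increasing family of seminorms induces the usual topology of the Schwartz space;
   the suprema are finite only for arguments in schwartz_space. *)
definition schwartz_seminorm :: "nat \<Rightarrow> (real^'n::finite \<Rightarrow> complex) \<Rightarrow> real" where
  "schwartz_seminorm N \<phi> =
     (\<Sum>\<beta> | length \<beta> \<le> N. SUP x. (1 + norm x) ^ N * cmod (partial_derivs \<beta> \<phi> x))"

(* Distributions are total functions in HOL; their values outside schwartz_space are irrelevant. *)
definition tempered_distribution :: "((real^'n::finite \<Rightarrow> complex) \<Rightarrow> complex) \<Rightarrow> bool" where
  "tempered_distribution T \<longleftrightarrow>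
     (\<forall>\<phi>\<in>schwartz_space. \<forall>\<psi>\<in>schwartz_space. T (\<lambda>x. \<phi> x + \<psi> x) = T \<phi> + T \<psi>) \<and>
     (\<forall>c. \<forall>\<phi>\<in>schwartz_space. T (\<lambda>x. c * \<phi> x) = c * T \<phi>) \<and>
     (\<exists>C N. \<forall>\<phi>\<in>schwartz_space. cmod (T \<phi>) \<le> C * schwartz_seminorm N \<phi>)"

(* For closed K: T vanishes on the open complement of K, tested against smooth functions with
   compact support. *)
definition supported_by ::
    "((real^'n::finite \<Rightarrow> complex) \<Rightarrow> complex) \<Rightarrow> (real^'n) set \<Rightarrow> bool" where
  "supported_by T K \<longleftrightarrow>
     (\<forall>\<phi>. smooth_fun \<phi> \<and> compact (closure {x. \<phi> x \<noteq> 0}) \<and> closure {x. \<phi> x \<noteq> 0} \<inter> K = {}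
          \<longrightarrow> T \<phi> = 0)"

(* No factor 2 * pi in the exponent: the spectrum is measured in angular frequencies, so that
   t \<mapsto> exp (- i (t \<bullet> x)) has spectrum {x}. *)
definition fourier :: "(real^'n::finite \<Rightarrow> complex) \<Rightarrow> real^'n \<Rightarrow> complex" where
  "fourier \<phi> x = (LINT t|lborel. exp (- \<i> * of_real (t \<bullet> x)) * \<phi> t)"

definition fourier_distribution ::
    "((real^'n::finite \<Rightarrow> complex) \<Rightarrow> complex) \<Rightarrow> (real^'n \<Rightarrow> complex) \<Rightarrow> complex" where
  "fourier_distribution T \<phi> = T (fourier \<phi>)"

(* f is identified with the tempered distribution \<phi> \<mapsto> \<integral> f \<phi>. *)
definition bernstein_space :: "(real^'n::finite) set \<Rightarrow> (real^'n \<Rightarrow> complex) set" where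
  "bernstein_space K = {f. continuous_on UNIV f \<and> bounded (range f) \<and>
     (\<exists>T. tempered_distribution T \<and> supported_by T K \<and>
        (\<forall>\<phi>\<in>schwartz_space. (LINT t|lborel. f t * \<phi> t) = fourier_distribution T \<phi>))}"

definition polar_body :: "(real^'n::finite) set \<Rightarrow> (real^'n) set" where
  "polar_body K = {x. \<forall>y\<in>K. x \<bullet> y \<le> 1}"

(* Suprema of absolute values are taken in ennreal, where the supremum over the empty set is 0. *)
definition stable_sampling_set :: "(real^'n::finite) set \<Rightarrow> (real^'n) set \<Rightarrow> bool" where
  "stable_sampling_set \<Lambda> K \<longleftrightarrow> (\<exists>C::real. \<forall>f\<in>bernstein_space K.
     (SUP t. ennreal (cmod (f t))) \<le> ennreal C * (SUP l\<in>\<Lambda>. ennreal (cmod (f l))))"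

end

theory Submission
  imports Defs "HOL-Complex_Analysis.Complex_Analysis" "HOL-Probability.Characteristic_Functions"
begin

text \<open>
The proof is a quantitative form of the classical fact that a function of exponential type
$1$ which is bounded by $M$ on the real line and takes the value $M$ at $0$ is at least
$M\cos s$ in absolute value at a point \<open>s\<close> with $|s| < \pi/2$.

Let $g$ be of exponential type at most $1$ and bounded by $M$ on the real line, let $0<\epsilon$,
$0<s$ and $s+\epsilon<\pi$. The residues of $g(z)/(z(z-s)\sin(z+\epsilon))$ add up to zero, which
expresses $g(0)/\sin\epsilon$ as $g(s)/\sin(s+\epsilon)$ plus a series over the values of $g$ at the
zeros of $\sin(z+\epsilon)$ (\<open>interpolation_error\<close>). The coefficients of the series
alternate in sign exactly as $\cos(z+\epsilon)$ does at these zeros. Hence the sum of their absolute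
values is found by interpolating the cosine itself (\<open>sum_abs_interp_weight\<close>), and
\[ \frac{|g(0)|}{\sin\epsilon}\le\frac{|g(s)|}{\sin(s+\epsilon)}
   + M\,(\cot\epsilon-\cot(s+\epsilon)). \]
Applied with $M=\sup|f|$ to the restrictions of $f\in B_K$ to lines that join an arbitrary point to a
sampling point, this gives $M\cos(s+\epsilon)\le\sup_\Lambda|f|$ after taking the supremum over all
points (\<open>bernstein_sup_le\<close>), and $s+\epsilon$ may tend to $\rho$. The polar body enters
because $x\in K^o$ and the symmetry of $K$ put $K$ into the strip $|x\cdot y|\le 1$, so that $f$ has
exponential type at most $1$ in the direction $x$; a slight shrinking of the direction makes the type
strictly less than $1$.

What remains is to justify the interpolation for an $f$ that is only known as the Fourier transform of a
tempered distribution $T$ supported by $K$. After convolution with a Gaussian, a weighted sum of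
values of $f$ along a line in direction $u$ is $T$ applied to a trigonometric sum
$\sum_\tau c_\tau e^{-i\tau(u\cdot x)}$ times a Gaussian. Interpolation of the exponentials
$e^{-iz\xi}$ shows that this sum is small for $|\xi|=|u\cdot x|<1$, but $T$ has some finite order $N$
and also sees derivatives of the sum. Therefore the exponentials are first multiplied by
$(\sin(\delta z)/(\delta z))^N$ with a small $\delta$, which is possible because the type is strictly less
than $1$ and makes the derivatives up to order $N$ small as well
(\<open>decaying_exponential_interpolation_error\<close>). Smallness on a neighbourhood of $K$ is enough
(\<open>distribution_trigonometric_bound\<close>), by means of a smooth cutoff function and of the fact
that $T$ annihilates Schwartz functions that vanish near $K$
(\<open>distribution_vanish_off_support\<close>).
\<close>

section \<open>Smooth functions\<close>

lemma partial_derivI: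
  "(f has_derivative f') (at x) \<Longrightarrow> partial_deriv i f x = f' (axis i 1)"
  unfolding partial_deriv_def using frechet_derivative_at by metis

lemma partial_derivs_simps [simp]:
  "partial_derivs [] f = f"
  "partial_derivs (i # \<beta>) f = partial_deriv i (partial_derivs \<beta> f)"
  by (simp_all add: partial_derivs_def)

lemma partial_derivs_append: "partial_derivs (\<beta> @ \<gamma>) f = partial_derivs \<beta> (partial_derivs \<gamma> f)"
  by (simp add: partial_derivs_def)

lemma smooth_fun_partial_derivs:
  "smooth_fun f \<Longrightarrow> smooth_fun (partial_derivs \<beta> f)"
  unfolding smooth_fun_def by (metis partial_derivs_append)

lemma smooth_fun_partial_deriv: "smooth_fun f \<Longrightarrow> smooth_fun (partial_deriv i f)"
  using smooth_fun_partial_derivs[of f "[i]"] by simp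

lemma smooth_fun_differentiable: "smooth_fun f \<Longrightarrow> f differentiable (at x)"
  unfolding smooth_fun_def by (metis partial_derivs_simps(1))

lemma smooth_fun_has_derivative:
  "smooth_fun f \<Longrightarrow> (f has_derivative frechet_derivative f (at x)) (at x)"
  by (simp add: smooth_fun_differentiable flip: frechet_derivative_works)

lemma smooth_fun_continuous_on: "smooth_fun f \<Longrightarrow> continuous_on A f"
  by (meson continuous_at_imp_continuous_on differentiable_imp_continuous_within smooth_fun_differentiable)

lemma partial_deriv_const [simp]: "partial_deriv i (\<lambda>x. c) = (\<lambda>x. 0)"
  by (rule ext) (rule partial_derivI[where f' = "\<lambda>_. 0"], auto)

lemma partial_derivs_const: "partial_derivs \<beta> (\<lambda>x. c) = (if \<beta> = [] then (\<lambda>x. c) else (\<lambda>x. 0))"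
  by (induction \<beta>) (auto split: if_splits)

lemma partial_deriv_add:
  assumes "f differentiable (at x)" "g differentiable (at x)"
  shows "partial_deriv i (\<lambda>x. f x + g x) x = partial_deriv i f x + partial_deriv i g x"
proof -
  have "((\<lambda>x. f x + g x) has_derivative
    (\<lambda>h. frechet_derivative f (at x) h + frechet_derivative g (at x) h)) (at x)"
    using assms by (intro has_derivative_add) (simp_all flip: frechet_derivative_works)
  from partial_derivI[OF this] show ?thesis by (simp add: partial_deriv_def)
qed

lemma partial_deriv_mult:
  assumes "f differentiable (at x)" "g differentiable (at x)"
  shows "partial_deriv i (\<lambda>x. f x * g x) x = partial_deriv i f x * g x + f x * partial_deriv i g x"
proof -
  have "((\<lambda>x. f x * g x) has_derivative
    (\<lambda>h. f x * frechet_derivative g (at x) h + frechet_derivative f (at x) h * g x)) (at x)"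
    using assms by (intro has_derivative_mult) (simp_all flip: frechet_derivative_works)
  from partial_derivI[OF this] show ?thesis by (simp add: partial_deriv_def)
qed

lemma partial_deriv_chain:
  fixes F :: "complex \<Rightarrow> complex"
  assumes "(F has_field_derivative d) (at (q x))" "q differentiable (at x)"
  shows "((\<lambda>x. F (q x)) has_derivative (\<lambda>h. d * frechet_derivative q (at x) h)) (at x)"
    "partial_deriv i (\<lambda>x. F (q x)) x = d * partial_deriv i q x"
proof -
  have q: "(q has_derivative frechet_derivative q (at x)) (at x)"
    using assms(2) by (simp flip: frechet_derivative_works)
  have "(F has_derivative (*) d) (at (q x))"
    using assms(1) by (simp add: has_field_derivative_def)
  from has_derivative_compose[OF q this]
  show 1: "((\<lambda>x. F (q x)) has_derivative (\<lambda>h. d * frechet_derivative q (at x) h)) (at x)"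
    by simp
  from partial_derivI[OF 1] show "partial_deriv i (\<lambda>x. F (q x)) x = d * partial_deriv i q x"
    by (simp add: partial_deriv_def)
qed

text \<open>
Smoothness asks for differentiability of all iterated partial derivatives at once, so it is
proved by exhibiting a class of differentiable functions that is closed under partial
differentiation. By the sum and product rules it is enough to check the generators of a ring of
functions.
\<close>
inductive_set fun_ring :: "(real^'n::finite \<Rightarrow> complex) set \<Rightarrow> (real^'n \<Rightarrow> complex) set"
  for B where
  base: "f \<in> B \<Longrightarrow> f \<in> fun_ring B"
| const: "(\<lambda>x. c) \<in> fun_ring B"
| add: "f \<in> fun_ring B \<Longrightarrow> g \<in> fun_ring B \<Longrightarrow> (\<lambda>x. f x + g x) \<in> fun_ring B"
| mult: "f \<in> fun_ring B \<Longrightarrow> g \<in> fun_ring B \<Longrightarrow> (\<lambda>x. f x * g x) \<in> fun_ring B"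

lemma fun_ring_partial_deriv:
  assumes B: "\<And>f. f \<in> B \<Longrightarrow> (\<forall>x. f differentiable (at x)) \<and> (\<forall>i. partial_deriv i f \<in> fun_ring B)"
  assumes "f \<in> fun_ring B"
  shows "(\<forall>x. f differentiable (at x)) \<and> (\<forall>i. partial_deriv i f \<in> fun_ring B)"
  using assms(2)
proof induction
  case (base f)
  then show ?case using B by blast
next
  case (const c)
  then show ?case by (auto intro: fun_ring.const)
next
  case (add f g)
  then have "partial_deriv i (\<lambda>x. f x + g x) = (\<lambda>x. partial_deriv i f x + partial_deriv i g x)" for i
    by (auto simp: partial_deriv_add)
  with add show ?case by (auto intro: fun_ring.add differentiable_add)
next
  case (mult f g)
  then have "partial_deriv i (\<lambda>x. f x * g x) =
     (\<lambda>x. partial_deriv i f x * g x + f x * partial_deriv i g x)" for i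
    by (auto simp: partial_deriv_mult)
  moreover have "(\<lambda>x. partial_deriv i f x * g x + f x * partial_deriv i g x) \<in> fun_ring B" for i
    using mult by (intro fun_ring.add fun_ring.mult) auto
  ultimately show ?case using mult by (auto intro: differentiable_mult)
qed

lemma fun_ring_partial_derivs:
  assumes B: "\<And>f. f \<in> B \<Longrightarrow> (\<forall>x. f differentiable (at x)) \<and> (\<forall>i. partial_deriv i f \<in> fun_ring B)"
  assumes "f \<in> fun_ring B"
  shows "partial_derivs \<beta> f \<in> fun_ring B"
  by (induction \<beta>) (use fun_ring_partial_deriv[OF B] assms(2) in auto)

text \<open>
The coinduction principle for smoothness: the partial derivatives of the generators need only
lie in the ring, not among the generators. For example $e^q$ has the derivative
$e^q \cdot \partial_i q$, a product of a generator and a smooth function.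
\<close>
lemma fun_ring_smooth:
  assumes B: "\<And>f. f \<in> B \<Longrightarrow> (\<forall>x. f differentiable (at x)) \<and> (\<forall>i. partial_deriv i f \<in> fun_ring B)"
  assumes "f \<in> fun_ring B"
  shows "smooth_fun f"
  unfolding smooth_fun_def
  using fun_ring_partial_deriv[OF B] fun_ring_partial_derivs[OF B assms(2)] by blast

lemma smooth_base:
  assumes "smooth_fun f" "Collect smooth_fun \<subseteq> B"
  shows "(\<forall>x. f differentiable (at x)) \<and> (\<forall>i. partial_deriv i f \<in> fun_ring B)"
  using assms smooth_fun_differentiable smooth_fun_partial_deriv fun_ring.base by blast

lemma fun_ring_smooth_eq: "fun_ring (Collect smooth_fun) = Collect smooth_fun"
  using fun_ring_smooth[of "Collect smooth_fun"] smooth_base[of _ "Collect smooth_fun"]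
  by (auto intro: fun_ring.base)

lemma smooth_fun_const: "smooth_fun (\<lambda>x. c)"
  using fun_ring.const[of c "Collect smooth_fun"] by (simp add: fun_ring_smooth_eq)

lemma smooth_fun_add: "smooth_fun f \<Longrightarrow> smooth_fun g \<Longrightarrow> smooth_fun (\<lambda>x. f x + g x)"
  using fun_ring.add[of f "Collect smooth_fun" g] by (simp add: fun_ring_smooth_eq)

lemma smooth_fun_mult: "smooth_fun f \<Longrightarrow> smooth_fun g \<Longrightarrow> smooth_fun (\<lambda>x. f x * g x)"
  using fun_ring.mult[of f "Collect smooth_fun" g] by (simp add: fun_ring_smooth_eq)

lemma smooth_fun_minus: "smooth_fun f \<Longrightarrow> smooth_fun g \<Longrightarrow> smooth_fun (\<lambda>x. f x - g x)"
  using smooth_fun_add[of f "\<lambda>x. - 1 * g x"] smooth_fun_mult[OF smooth_fun_const[of "-1"], of g]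
  by simp

lemma smooth_fun_exp:
  assumes "smooth_fun q"
  shows "smooth_fun (\<lambda>x. exp (q x))"
proof -
  let ?e = "\<lambda>x. exp (q x)"
  let ?B = "insert ?e (Collect smooth_fun)"
  have 1: "((\<lambda>x. exp (q x)) has_derivative (\<lambda>h. exp (q x) * frechet_derivative q (at x) h)) (at x)"
    and 2: "partial_deriv i ?e x = exp (q x) * partial_deriv i q x" for x i
    using partial_deriv_chain[of exp "exp (q x)" q x] assms smooth_fun_differentiable
    by (auto simp: DERIV_exp)
  have 3: "partial_deriv i ?e = (\<lambda>x. exp (q x) * partial_deriv i q x)" for i
    using 2 by auto
  have "partial_deriv i ?e \<in> fun_ring ?B" for i
    unfolding 3 using assms smooth_fun_partial_deriv by (intro fun_ring.mult fun_ring.base) auto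
  moreover have "?e differentiable (at x)" for x
    using 1 unfolding differentiable_def by blast
  ultimately have "(\<forall>x. f differentiable (at x)) \<and> (\<forall>i. partial_deriv i f \<in> fun_ring ?B)" if "f \<in> ?B" for f
    using that smooth_base[of f ?B] by (cases "f = ?e") auto
  from fun_ring_smooth[OF this] show ?thesis by (auto intro: fun_ring.base)
qed

lemma smooth_fun_inverse:
  assumes "smooth_fun q" and nz: "\<And>x. q x \<noteq> 0"
  shows "smooth_fun (\<lambda>x. inverse (q x))"
proof -
  let ?e = "\<lambda>x. inverse (q x)"
  let ?B = "insert ?e (Collect smooth_fun)"
  have 1: "(?e has_derivative (\<lambda>h. - (inverse (q x) * inverse (q x)) * frechet_derivative q (at x) h)) (at x)"
    and 2: "partial_deriv i ?e x = - (inverse (q x) * inverse (q x)) * partial_deriv i q x" for x i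
    using partial_deriv_chain[of inverse "- (inverse (q x) * inverse (q x))" q x] assms smooth_fun_differentiable
      DERIV_inverse'[OF DERIV_ident, of "q x"]
    by (auto )
  have 3: "partial_deriv i ?e = (\<lambda>x. (-1 * (inverse (q x) * inverse (q x))) * partial_deriv i q x)" for i
    using 2 by auto
  have "partial_deriv i ?e \<in> fun_ring ?B" for i
    unfolding 3 using assms smooth_fun_partial_deriv
    by (intro fun_ring.mult fun_ring.const) (auto intro: fun_ring.base)
  moreover have "?e differentiable (at x)" for x
    using 1 unfolding differentiable_def by blast
  ultimately have "(\<forall>x. f differentiable (at x)) \<and> (\<forall>i. partial_deriv i f \<in> fun_ring ?B)" if "f \<in> ?B" for f
    using that smooth_base[of f ?B] by (cases "f = ?e") auto
  from fun_ring_smooth[OF this] show ?thesis by (auto intro: fun_ring.base)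
qed

text \<open>
The classical flat function and its relatives: $e^{-1/x}/x^k$ on the positive half line. The
powers of $x$ are included because the family, unlike its member $k = 0$ alone, is closed under
differentiation up to linear combinations, as the ring argument above needs.
\<close>
definition flat_exp :: "nat \<Rightarrow> real \<Rightarrow> real" where
  "flat_exp k x = (if x > 0 then exp (- 1 / x) / x ^ k else 0)"

lemma flat_exp_tendsto_0: "(flat_exp k \<longlongrightarrow> 0) (at_right 0)"
proof -
  have "((\<lambda>t::real. t ^ k / exp t) \<longlongrightarrow> 0) at_top"
    by (rule tendsto_power_div_exp_0)
  then have "((\<lambda>x. inverse x ^ k / exp (inverse x)) \<longlongrightarrow> (0::real)) (at_right 0)"
    by (rule filterlim_compose[OF _ filterlim_inverse_at_top_right])
  then show ?thesis
    by (rule Lim_transform_eventually)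
      (auto simp: flat_exp_def eventually_at_right_less field_simps exp_minus intro!: eventually_at_rightI[of 0 1])
qed

lemma flat_exp_has_derivative:
  "(flat_exp k has_real_derivative flat_exp (k + 2) x - of_nat k * flat_exp (k + 1) x) (at x)"
proof -
  consider "x > 0" | "x < 0" | "x = 0" by linarith
  then show ?thesis
  proof cases
    case 1
    have "((\<lambda>x. exp (- 1 / x) / x ^ k) has_real_derivative
        flat_exp (k + 2) x - of_nat k * flat_exp (k + 1) x) (at x)"
      using 1 by (auto intro!: derivative_eq_intros simp: flat_exp_def field_simps power2_eq_square power_Suc split: nat.splits)
       (cases k; simp add: field_simps)
    then show ?thesis
      by (rule has_field_derivative_transform_within_open[where S = "{0<..}"])
        (use 1 in \<open>auto simp: flat_exp_def\<close>)
  next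
    case 2
    have "((\<lambda>x. 0) has_real_derivative flat_exp (k + 2) x - of_nat k * flat_exp (k + 1) x) (at x)"
      using 2 by (auto simp: flat_exp_def)
    then show ?thesis
      by (rule has_field_derivative_transform_within_open[where S = "{..<0}"])
        (use 2 in \<open>auto simp: flat_exp_def\<close>)
  next
    case 3
    have "((\<lambda>h. flat_exp k h / h) \<longlongrightarrow> 0) (at_right 0)"
      by (rule Lim_transform_eventually[OF flat_exp_tendsto_0[of "k + 1"]])
        (auto simp: flat_exp_def eventually_at_filter)
    moreover have "((\<lambda>h. flat_exp k h / h) \<longlongrightarrow> 0) (at_left 0)"
      by (rule Lim_transform_eventually[OF tendsto_const])
        (auto simp: flat_exp_def eventually_at_filter)
    ultimately have "((\<lambda>h. flat_exp k h / h) \<longlongrightarrow> 0) (at 0)"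
      by (simp add: filterlim_split_at)
    with 3 show ?thesis
      by (simp add: DERIV_def flat_exp_def)
  qed
qed

lemma smooth_fun_flat_exp:
  fixes q :: "real^'n::finite \<Rightarrow> real"
  assumes "smooth_fun (\<lambda>x. complex_of_real (q x))"
  shows "smooth_fun (\<lambda>x. complex_of_real (flat_exp k (q x)))"
proof -
  let ?c = "\<lambda>x. complex_of_real (q x)"
  let ?e = "\<lambda>k x. complex_of_real (flat_exp k (q x))"
  let ?B = "range ?e \<union> Collect smooth_fun"
  have c: "(?c has_derivative frechet_derivative ?c (at x)) (at x)" for x
    using smooth_fun_has_derivative assms by blast
  have d: "(?e k has_derivative (\<lambda>h. of_real (flat_exp (k + 2) (q x) - of_nat k * flat_exp (k + 1) (q x))
       * frechet_derivative ?c (at x) h)) (at x)" for k x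
  proof -
    let ?d = "flat_exp (k + 2) (q x) - of_nat k * flat_exp (k + 1) (q x)"
    have "((\<lambda>z. flat_exp k (Re z)) has_derivative (\<lambda>h. ?d * Re h)) (at (?c x))"
      using has_derivative_compose[OF has_derivative_Re[OF has_derivative_ident], of "flat_exp k" "(*) ?d" "?c x" UNIV]
        flat_exp_has_derivative[of k "q x"] by (simp add: has_field_derivative_def)
    from has_derivative_compose[OF c this]
    have "((\<lambda>x. flat_exp k (q x)) has_derivative (\<lambda>h. ?d * Re (frechet_derivative ?c (at x) h))) (at x)"
      by simp
    from has_derivative_of_real[OF this]
    have *: "(?e k has_derivative (\<lambda>h. of_real (?d * Re (frechet_derivative ?c (at x) h)))) (at x)" .
    have "((\<lambda>x. Im (?c x)) has_derivative (\<lambda>h. Im (frechet_derivative ?c (at x) h))) (at x)"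
      by (rule has_derivative_Im[OF c])
    then have "(\<lambda>h. Im (frechet_derivative ?c (at x) h)) = (\<lambda>h. 0)"
      using has_derivative_unique[OF _ has_derivative_const[of 0]] by simp
    then have "Im (frechet_derivative ?c (at x) h) = 0" for h by meson
    then have "of_real (?d * Re (frechet_derivative ?c (at x) h)) = of_real ?d * frechet_derivative ?c (at x) h" for h
      by (simp add: complex_eq_iff)
    with * show ?thesis by (simp only:)
  qed
  have 3: "partial_deriv i (?e k) =
    (\<lambda>x. (?e (k + 2) x + (- of_nat k) * ?e (k + 1) x) * partial_deriv i ?c x)" for i k
    by (rule ext, subst partial_derivI[OF d]) (simp add: partial_deriv_def)
  have "partial_deriv i (?e k) \<in> fun_ring ?B" for i k
    unfolding 3 by (intro fun_ring.mult fun_ring.add fun_ring.const fun_ring.base)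
      (use assms smooth_fun_partial_deriv in auto)
  moreover have "?e k differentiable (at x)" for k x
    using d unfolding differentiable_def by blast
  ultimately have "(\<forall>x. f differentiable (at x)) \<and> (\<forall>i. partial_deriv i f \<in> fun_ring ?B)" if "f \<in> ?B" for f
    using that smooth_base[of f ?B] by blast
  from fun_ring_smooth[OF this] show ?thesis by (auto intro: fun_ring.base)
qed

section \<open>Multipliers, Schwartz functions and the order of a distribution\<close>

lemma partial_derivs_snoc: "partial_derivs (\<beta> @ [i]) f = partial_derivs \<beta> (partial_deriv i f)"
  by (simp add: partial_derivs_append)

lemma partial_derivs_add:
  assumes "smooth_fun f" "smooth_fun g"
  shows "partial_derivs \<beta> (\<lambda>x. f x + g x) = (\<lambda>x. partial_derivs \<beta> f x + partial_derivs \<beta> g x)"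
proof (induction \<beta>)
  case (Cons i \<beta>)
  have "partial_derivs \<beta> f differentiable (at x)" "partial_derivs \<beta> g differentiable (at x)" for x
    using assms by (auto simp: smooth_fun_def)
  then show ?case by (simp add: Cons partial_deriv_add fun_eq_iff)
qed simp

lemma partial_deriv_mult_smooth:
  assumes "smooth_fun f" "smooth_fun g"
  shows "partial_deriv i (\<lambda>x. f x * g x) = (\<lambda>x. partial_deriv i f x * g x + f x * partial_deriv i g x)"
  using assms by (auto simp: partial_deriv_mult smooth_fun_differentiable)

text \<open>
A quantitative Leibniz rule at one point. Each derivative doubles the number of terms, whence the
factor $2^{|\beta|}$. The induction removes the innermost
direction of \<open>\<beta>\<close>, which is the one that acts first on the product.
\<close>
lemma leibniz_bound_aux:
  assumes fg: "smooth_fun f" "smooth_fun g" and "0 \<le> u" "0 \<le> v"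
    and u: "\<And>\<gamma>. length \<gamma> \<le> N \<Longrightarrow> cmod (partial_derivs \<gamma> f x) \<le> u"
    and v: "\<And>\<gamma>. length \<gamma> \<le> N \<Longrightarrow> cmod (partial_derivs \<gamma> g x) \<le> v"
    and "length \<beta> + length \<gamma> \<le> N" "length \<beta> + length \<delta> \<le> N"
  shows "cmod (partial_derivs \<beta> (\<lambda>x. partial_derivs \<gamma> f x * partial_derivs \<delta> g x) x) \<le> 2 ^ length \<beta> * (u * v)"
  using assms(7,8)
proof (induction \<beta> arbitrary: \<gamma> \<delta> rule: rev_induct)
  case Nil
  then show ?case using u[of \<gamma>] v[of \<delta>] \<open>0 \<le> u\<close> by (auto simp: norm_mult intro!: mult_mono)
next
  case (snoc i \<beta>)
  let ?f = "\<lambda>x. partial_derivs (i # \<gamma>) f x * partial_derivs \<delta> g x"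
  let ?g = "\<lambda>x. partial_derivs \<gamma> f x * partial_derivs (i # \<delta>) g x"
  have sm: "smooth_fun (partial_derivs \<gamma> f)" "smooth_fun (partial_derivs \<delta> g)"
    "smooth_fun (partial_derivs (i # \<gamma>) f)" "smooth_fun (partial_derivs (i # \<delta>) g)"
    using fg smooth_fun_partial_derivs by blast+
  have "partial_derivs (\<beta> @ [i]) (\<lambda>x. partial_derivs \<gamma> f x * partial_derivs \<delta> g x)
      = partial_derivs \<beta> (\<lambda>x. ?f x + ?g x)"
    unfolding partial_derivs_snoc using sm by (simp add: partial_deriv_mult_smooth)
  also have "\<dots> = (\<lambda>x. partial_derivs \<beta> ?f x + partial_derivs \<beta> ?g x)"
    by (intro partial_derivs_add smooth_fun_mult sm)
  finally have "cmod (partial_derivs (\<beta> @ [i]) (\<lambda>x. partial_derivs \<gamma> f x * partial_derivs \<delta> g x) x)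
     \<le> cmod (partial_derivs \<beta> ?f x) + cmod (partial_derivs \<beta> ?g x)"
    by (simp add: norm_triangle_ineq)
  also have "\<dots> \<le> 2 ^ length \<beta> * (u * v) + 2 ^ length \<beta> * (u * v)"
    using snoc.prems by (intro add_mono snoc.IH) auto
  finally show ?case by (simp add: algebra_simps)
qed

lemma leibniz_bound:
  assumes "smooth_fun f" "smooth_fun g" "0 \<le> u" "0 \<le> v"
    and "\<And>\<gamma>. length \<gamma> \<le> N \<Longrightarrow> cmod (partial_derivs \<gamma> f x) \<le> u"
    and "\<And>\<gamma>. length \<gamma> \<le> N \<Longrightarrow> cmod (partial_derivs \<gamma> g x) \<le> v"
    and "length \<beta> \<le> N"
  shows "cmod (partial_derivs \<beta> (\<lambda>x. f x * g x) x) \<le> 2 ^ N * (u * v)"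
proof -
  have "cmod (partial_derivs \<beta> (\<lambda>x. f x * g x) x) \<le> 2 ^ length \<beta> * (u * v)"
    using leibniz_bound_aux[of f g u v N x \<beta> "[]" "[]"] assms by simp
  also have "\<dots> \<le> 2 ^ N * (u * v)"
    using assms by (intro mult_right_mono power_increasing) auto
  finally show ?thesis .
qed

lemma partial_derivs_eq_0_on_open:
  assumes "open U" "\<And>x. x \<in> U \<Longrightarrow> f x = 0" "x \<in> U"
  shows "partial_derivs \<beta> f x = 0"
  using assms(3)
proof (induction \<beta> arbitrary: x)
  case (Cons i \<beta>)
  have "(partial_derivs \<beta> f has_derivative (\<lambda>_. 0)) (at x)"
    by (rule has_derivative_transform_within_open[OF has_derivative_const assms(1) Cons.prems])
      (simp add: Cons.IH)
  from partial_derivI[OF this] show ?case by simp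
qed (simp add: assms(2))

lemma uniform_bound_short_lists:
  fixes P :: "'n::finite list \<Rightarrow> real \<Rightarrow> bool"
  assumes "\<And>\<beta>. \<exists>C. P \<beta> C" and mono: "\<And>\<beta> C D. P \<beta> C \<Longrightarrow> C \<le> D \<Longrightarrow> P \<beta> D"
  obtains C where "C \<ge> 0" "\<And>\<beta>. length \<beta> \<le> N \<Longrightarrow> P \<beta> C"
proof -
  obtain c where c: "P \<beta> (c \<beta>)" for \<beta> using assms(1) by metis
  let ?L = "{\<beta>::'n list. length \<beta> \<le> N}"
  have fin: "finite ?L" using finite_lists_length_le[of "UNIV :: 'n set" N] by simp
  let ?C = "\<Sum>\<beta>\<in>?L. \<bar>c \<beta>\<bar>"
  have "P \<beta> ?C" if "length \<beta> \<le> N" for \<beta>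
  proof (rule mono[OF c])
    have "\<bar>c \<beta>\<bar> \<le> ?C" using fin that by (intro member_le_sum) auto
    then show "c \<beta> \<le> ?C" by linarith
  qed
  then show ?thesis using that[of ?C] by (simp add: sum_nonneg)
qed

text \<open>
These functions act on the Schwartz space by multiplication.
\<close>
definition bounded_derivs :: "(real^'n::finite \<Rightarrow> complex) \<Rightarrow> bool" where
  "bounded_derivs g \<longleftrightarrow> smooth_fun g \<and> (\<forall>\<beta>. \<exists>C. \<forall>x. cmod (partial_derivs \<beta> g x) \<le> C)"

lemma bounded_derivs_uniform:
  assumes "bounded_derivs g"
  obtains C where "C \<ge> 0" "\<And>\<beta> x. length \<beta> \<le> N \<Longrightarrow> cmod (partial_derivs \<beta> g x) \<le> C"
proof (rule uniform_bound_short_lists[of "\<lambda>\<beta> C. \<forall>x. cmod (partial_derivs \<beta> g x) \<le> C" N])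
  show "\<exists>C. \<forall>x. cmod (partial_derivs \<beta> g x) \<le> C" for \<beta>
    using assms unfolding bounded_derivs_def by blast
qed (use that order_trans in blast)+

lemma bounded_derivs_add:
  assumes "bounded_derivs f" "bounded_derivs g"
  shows "bounded_derivs (\<lambda>x. f x + g x)"
  unfolding bounded_derivs_def
proof (intro conjI allI)
  fix \<beta>
  obtain C D where "\<forall>x. cmod (partial_derivs \<beta> f x) \<le> C" "\<forall>x. cmod (partial_derivs \<beta> g x) \<le> D"
    using assms unfolding bounded_derivs_def by blast
  then have "\<forall>x. cmod (partial_derivs \<beta> (\<lambda>x. f x + g x) x) \<le> C + D"
    using assms by (auto simp: bounded_derivs_def partial_derivs_add intro: norm_triangle_mono)
  then show "\<exists>C. \<forall>x. cmod (partial_derivs \<beta> (\<lambda>x. f x + g x) x) \<le> C" ..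
qed (use assms smooth_fun_add in \<open>auto simp: bounded_derivs_def\<close>)

lemma bounded_derivs_mult:
  assumes "bounded_derivs f" "bounded_derivs g"
  shows "bounded_derivs (\<lambda>x. f x * g x)"
  unfolding bounded_derivs_def
proof (intro conjI allI)
  fix \<beta> :: "'a list"
  obtain C where C: "C \<ge> 0" "\<And>\<gamma> x. length \<gamma> \<le> length \<beta> \<Longrightarrow> cmod (partial_derivs \<gamma> f x) \<le> C"
    using bounded_derivs_uniform[OF assms(1)] by metis
  obtain D where D: "D \<ge> 0" "\<And>\<gamma> x. length \<gamma> \<le> length \<beta> \<Longrightarrow> cmod (partial_derivs \<gamma> g x) \<le> D"
    using bounded_derivs_uniform[OF assms(2)] by metis
  have "cmod (partial_derivs \<beta> (\<lambda>x. f x * g x) x) \<le> 2 ^ length \<beta> * (C * D)" for x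
    using assms C D by (intro leibniz_bound) (auto simp: bounded_derivs_def)
  then show "\<exists>C. \<forall>x. cmod (partial_derivs \<beta> (\<lambda>x. f x * g x) x) \<le> C" by blast
qed (use assms smooth_fun_mult in \<open>auto simp: bounded_derivs_def\<close>)

lemma bounded_derivs_const: "bounded_derivs (\<lambda>x. c)"
  unfolding bounded_derivs_def
  by (auto simp: partial_derivs_const smooth_fun_const intro: exI[of _ "cmod c"])

lemma bounded_derivs_one_minus:
  "bounded_derivs f \<Longrightarrow> bounded_derivs (\<lambda>x. 1 - f x)"
  using bounded_derivs_add[OF bounded_derivs_const[of 1] bounded_derivs_mult[OF bounded_derivs_const[of "-1"]], of f]
  by simp

lemma smooth_compact_support_bounded_derivs:
  assumes "smooth_fun f" "\<And>x. norm x > R \<Longrightarrow> f x = 0"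
  shows "bounded_derivs f"
  unfolding bounded_derivs_def
proof (intro conjI allI assms)
  fix \<beta>
  have 0: "partial_derivs \<beta> f x = 0" if "norm x > R" for x
    by (rule partial_derivs_eq_0_on_open[where U = "- cball 0 R"]) (use assms that in auto)
  have "continuous_on (cball 0 R) (partial_derivs \<beta> f)"
    using assms(1) smooth_fun_partial_derivs smooth_fun_continuous_on by blast
  then have "bounded (partial_derivs \<beta> f ` cball 0 R)"
    by (intro compact_imp_bounded compact_continuous_image) auto
  then obtain C where C: "\<forall>x\<in>cball 0 R. cmod (partial_derivs \<beta> f x) \<le> C"
    unfolding bounded_iff by auto
  have "cmod (partial_derivs \<beta> f x) \<le> max C 0" for x
    using C 0[of x] by (cases "norm x \<le> R") (auto simp: le_max_iff_disj)
  then show "\<exists>C. \<forall>x. cmod (partial_derivs \<beta> f x) \<le> C" by blast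
qed

lemma partial_derivs_scale:
  fixes f :: "real^'n::finite \<Rightarrow> complex"
  assumes "smooth_fun f"
  shows "partial_derivs \<beta> (\<lambda>x. f (c *\<^sub>R x)) = (\<lambda>x. of_real (c ^ length \<beta>) * partial_derivs \<beta> f (c *\<^sub>R x))"
proof (induction \<beta>)
  case (Cons i \<beta>)
  show ?case
  proof
    fix x
    let ?g = "partial_derivs \<beta> f"
    let ?D = "frechet_derivative ?g (at (c *\<^sub>R x))"
    have g: "(?g has_derivative ?D) (at (c *\<^sub>R x))"
      using assms smooth_fun_partial_derivs smooth_fun_has_derivative by blast
    have sc: "((\<lambda>x. c *\<^sub>R x) has_derivative (\<lambda>h. c *\<^sub>R h)) (at x)"
      by (auto intro!: derivative_eq_intros)
    have "((\<lambda>x. ?g (c *\<^sub>R x)) has_derivative (\<lambda>h. ?D (c *\<^sub>R h))) (at x)"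
      by (rule has_derivative_compose[OF sc g])
    then have "((\<lambda>x. of_real (c ^ length \<beta>) * ?g (c *\<^sub>R x)) has_derivative
        (\<lambda>h. of_real (c ^ length \<beta>) * ?D (c *\<^sub>R h))) (at x)"
      by (rule has_derivative_mult_right)
    from partial_derivI[OF this, of i]
    have "partial_deriv i (\<lambda>x. of_real (c ^ length \<beta>) * ?g (c *\<^sub>R x)) x
       = of_real (c ^ length \<beta>) * ?D (c *\<^sub>R axis i 1)" .
    also have "?D (c *\<^sub>R axis i 1) = c *\<^sub>R ?D (axis i 1)"
      using has_derivative_bounded_linear[OF g] by (intro linear_scale bounded_linear.linear)
    also have "\<dots> = of_real c * ?D (axis i 1)"
      by (rule scaleR_conv_of_real)
    finally show "partial_derivs (i # \<beta>) (\<lambda>x. f (c *\<^sub>R x)) x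
      = of_real (c ^ length (i # \<beta>)) * partial_derivs (i # \<beta>) f (c *\<^sub>R x)"
      by (simp add: Cons partial_deriv_def)
  qed
qed simp

lemma schwartz_space_iff:
  "\<phi> \<in> schwartz_space \<longleftrightarrow> smooth_fun \<phi> \<and>
     (\<forall>N \<beta>. \<exists>C. \<forall>x. (1 + norm x) ^ N * cmod (partial_derivs \<beta> \<phi> x) \<le> C)"
  unfolding schwartz_space_def bounded_iff by (simp add: norm_power)

lemma schwartz_uniform:
  assumes "\<phi> \<in> schwartz_space"
  obtains C where "C \<ge> 0"
    "\<And>\<beta> x. length \<beta> \<le> M \<Longrightarrow> cmod (partial_derivs \<beta> \<phi> x) \<le> C / (1 + norm x) ^ N"
proof (rule uniform_bound_short_lists[of "\<lambda>\<beta> C. \<forall>x. (1 + norm x) ^ N * cmod (partial_derivs \<beta> \<phi> x) \<le> C" M])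
  show "\<exists>C. \<forall>x. (1 + norm x) ^ N * cmod (partial_derivs \<beta> \<phi> x) \<le> C" for \<beta>
    using assms unfolding schwartz_space_iff by blast
next
  fix C assume "C \<ge> 0" and C: "\<And>\<beta>. length \<beta> \<le> M \<Longrightarrow>
    \<forall>x. (1 + norm x) ^ N * cmod (partial_derivs \<beta> \<phi> x) \<le> C"
  then show thesis
    by (intro that[of C]) (simp_all add: add_pos_nonneg pos_le_divide_eq mult.commute)
qed (use order_trans in blast)

lemma schwartz_space_add:
  assumes "\<phi> \<in> schwartz_space" "\<psi> \<in> schwartz_space"
  shows "(\<lambda>x. \<phi> x + \<psi> x) \<in> schwartz_space"
  unfolding schwartz_space_iff
proof (intro conjI allI)
  fix N \<beta>
  obtain C D where "\<forall>x. (1 + norm x) ^ N * cmod (partial_derivs \<beta> \<phi> x) \<le> C"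
     "\<forall>x. (1 + norm x) ^ N * cmod (partial_derivs \<beta> \<psi> x) \<le> D"
    using assms unfolding schwartz_space_iff by blast
  moreover have "(1 + norm x) ^ N * cmod (partial_derivs \<beta> (\<lambda>x. \<phi> x + \<psi> x) x) \<le>
     (1 + norm x) ^ N * cmod (partial_derivs \<beta> \<phi> x) + (1 + norm x) ^ N * cmod (partial_derivs \<beta> \<psi> x)" for x
    using assms by (auto simp: partial_derivs_add schwartz_space_iff norm_triangle_ineq
       simp flip: distrib_left intro!: mult_left_mono)
  ultimately have "\<forall>x. (1 + norm x) ^ N * cmod (partial_derivs \<beta> (\<lambda>x. \<phi> x + \<psi> x) x) \<le> C + D"
    by (meson add_mono order_trans)
  then show "\<exists>C. \<forall>x. (1 + norm x) ^ N * cmod (partial_derivs \<beta> (\<lambda>x. \<phi> x + \<psi> x) x) \<le> C" ..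
qed (use assms smooth_fun_add in \<open>auto simp: schwartz_space_iff\<close>)

lemma schwartz_space_mult:
  assumes g: "bounded_derivs g" and \<theta>: "\<theta> \<in> schwartz_space"
  shows "(\<lambda>x. g x * \<theta> x) \<in> schwartz_space"
  unfolding schwartz_space_iff
proof (intro conjI allI)
  fix N and \<beta> :: "'a list"
  obtain C where C: "C \<ge> 0" "\<And>\<gamma> x. length \<gamma> \<le> length \<beta> \<Longrightarrow> cmod (partial_derivs \<gamma> g x) \<le> C"
    using bounded_derivs_uniform[OF g] by metis
  obtain D where D: "D \<ge> 0"
    "\<And>\<gamma> x. length \<gamma> \<le> length \<beta> \<Longrightarrow> cmod (partial_derivs \<gamma> \<theta> x) \<le> D / (1 + norm x) ^ N"
    using schwartz_uniform[OF \<theta>] by metis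
  have "cmod (partial_derivs \<beta> (\<lambda>x. g x * \<theta> x) x) \<le> 2 ^ length \<beta> * (C * (D / (1 + norm x) ^ N))" for x
    using assms C D by (intro leibniz_bound) (auto simp: bounded_derivs_def schwartz_space_iff)
  moreover have "(1 + norm x) ^ N > 0" for x :: "real^'a" by (simp add: add_pos_nonneg)
  ultimately have "(1 + norm x) ^ N * cmod (partial_derivs \<beta> (\<lambda>x. g x * \<theta> x) x) \<le> 2 ^ length \<beta> * (C * D)" for x
    by (simp add: field_simps)
  then show "\<exists>C. \<forall>x. (1 + norm x) ^ N * cmod (partial_derivs \<beta> (\<lambda>x. g x * \<theta> x) x) \<le> C" by blast
qed (use assms smooth_fun_mult in \<open>auto simp: schwartz_space_iff bounded_derivs_def\<close>)

lemma schwartz_space_cmult: "\<phi> \<in> schwartz_space \<Longrightarrow> (\<lambda>x. c * \<phi> x) \<in> schwartz_space"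
  using schwartz_space_mult[OF bounded_derivs_const] .

lemma tempered_distribution_add:
  "tempered_distribution T \<Longrightarrow> \<phi> \<in> schwartz_space \<Longrightarrow> \<psi> \<in> schwartz_space \<Longrightarrow>
    T (\<lambda>x. \<phi> x + \<psi> x) = T \<phi> + T \<psi>"
  by (simp add: tempered_distribution_def)

lemma tempered_distribution_cmult:
  "tempered_distribution T \<Longrightarrow> \<phi> \<in> schwartz_space \<Longrightarrow> T (\<lambda>x. c * \<phi> x) = c * T \<phi>"
  by (simp add: tempered_distribution_def)

lemma tempered_distribution_sum:
  assumes T: "tempered_distribution T" and "finite A" "\<And>a. a \<in> A \<Longrightarrow> \<phi> a \<in> schwartz_space"
  shows "(\<lambda>x. \<Sum>a\<in>A. c a * \<phi> a x) \<in> schwartz_space \<and> T (\<lambda>x. \<Sum>a\<in>A. c a * \<phi> a x) = (\<Sum>a\<in>A. c a * T (\<phi> a))"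
  using assms(2,3)
proof (induction A)
  case empty
  have z: "(\<lambda>x::real^'a. 0::complex) \<in> schwartz_space"
    by (auto simp: schwartz_space_iff smooth_fun_const partial_derivs_const)
  show ?case using z tempered_distribution_cmult[OF T z, of 0] by simp
next
  case (insert a A)
  then have s: "(\<lambda>x. \<Sum>a\<in>A. c a * \<phi> a x) \<in> schwartz_space" "\<phi> a \<in> schwartz_space"
    "(\<lambda>x. c a * \<phi> a x) \<in> schwartz_space"
    and IH: "T (\<lambda>x. \<Sum>a\<in>A. c a * \<phi> a x) = (\<Sum>a\<in>A. c a * T (\<phi> a))"
    by (auto intro: schwartz_space_cmult)
  have "T (\<lambda>x. c a * \<phi> a x + (\<Sum>a\<in>A. c a * \<phi> a x)) = T (\<lambda>x. c a * \<phi> a x) + T (\<lambda>x. \<Sum>a\<in>A. c a * \<phi> a x)"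
    using tempered_distribution_add[OF T s(3,1)] .
  moreover have "T (\<lambda>x. c a * \<phi> a x) = c a * T (\<phi> a)"
    using tempered_distribution_cmult[OF T s(2)] .
  ultimately show ?case
    using insert s IH by (simp add: schwartz_space_add)
qed

text \<open>
Continuity of \<open>T\<close> in the form in which it is used: for a fixed Schwartz function
\<open>\<theta>\<close> that vanishes off \<open>S\<close>, the value of \<open>T\<close> at
$g\theta$ is controlled by finitely many derivatives of the multiplier \<open>g\<close> on
\<open>S\<close> alone. The weight $1 + |x|$ is harmless against the decay of
\<open>\<theta>\<close>, and makes a cutoff near infinity, which is bounded by $(1+|x|)/R$
because it lives on $|x| \ge R$, a small multiplier.
\<close>
definition multiplier_bound ::
    "((real^'n::finite \<Rightarrow> complex) \<Rightarrow> complex) \<Rightarrow> nat \<Rightarrow> (real^'n \<Rightarrow> complex) \<Rightarrow> (real^'n) set \<Rightarrow> real \<Rightarrow> bool" where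
  "multiplier_bound T N \<theta> S B \<longleftrightarrow>
    (\<forall>g b. bounded_derivs g \<longrightarrow> b \<ge> 0 \<longrightarrow>
        (\<forall>\<gamma>. \<forall>x\<in>S. length \<gamma> \<le> N \<longrightarrow> cmod (partial_derivs \<gamma> g x) \<le> b * (1 + norm x)) \<longrightarrow>
        cmod (T (\<lambda>x. g x * \<theta> x)) \<le> B * b)"

text \<open>
Only the derivatives up to order \<open>N\<close> matter, and \<open>N\<close> does not depend on
\<open>\<theta>\<close>. The interpolation series below is summed against a kernel whose decay is
chosen after \<open>N\<close>.
\<close>
definition distribution_order :: "((real^'n::finite \<Rightarrow> complex) \<Rightarrow> complex) \<Rightarrow> nat \<Rightarrow> bool" where
  "distribution_order T N \<longleftrightarrow>
    (\<forall>\<theta>\<in>schwartz_space. \<forall>S. closed S \<longrightarrow> (\<forall>x. x \<notin> S \<longrightarrow> \<theta> x = 0) \<longrightarrow>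
      (\<exists>B. multiplier_bound T N \<theta> S B))"

lemma multiplier_boundD:
  assumes "multiplier_bound T N \<theta> S B" "bounded_derivs g" "b \<ge> 0"
    "\<And>\<gamma> x. x \<in> S \<Longrightarrow> length \<gamma> \<le> N \<Longrightarrow> cmod (partial_derivs \<gamma> g x) \<le> b * (1 + norm x)"
  shows "cmod (T (\<lambda>x. g x * \<theta> x)) \<le> B * b"
  using assms unfolding multiplier_bound_def by blast

text \<open>
By the Leibniz rule every seminorm of $g\theta$ of order \<open>N\<close> is at most the bound on
\<open>g\<close> times a seminorm of \<open>\<theta>\<close> with one more power of $1+|x|$.
\<close>
lemma tempered_distribution_order:
  fixes T :: "(real^'n::finite \<Rightarrow> complex) \<Rightarrow> complex"
  assumes T: "tempered_distribution T"
  shows "\<exists>N. distribution_order T N"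
proof -
  obtain C0 N where CN: "\<forall>\<phi>\<in>schwartz_space. cmod (T \<phi>) \<le> C0 * schwartz_seminorm N \<phi>"
    using T unfolding tempered_distribution_def by blast
  have "distribution_order T N"
    unfolding distribution_order_def
  proof (intro ballI allI impI)
    fix \<theta> :: "real^'n \<Rightarrow> complex" and S
    assume \<theta>: "\<theta> \<in> schwartz_space" and S: "closed S" "\<forall>x. x \<notin> S \<longrightarrow> \<theta> x = 0"
    let ?L = "{\<beta>::'n list. length \<beta> \<le> N}"
    obtain D where D: "D \<ge> 0"
      "\<And>\<gamma> x. length \<gamma> \<le> N \<Longrightarrow> cmod (partial_derivs \<gamma> \<theta> x) \<le> D / (1 + norm x) ^ Suc N"
      using schwartz_uniform[OF \<theta>] by metis
    let ?B = "\<bar>C0\<bar> * (of_nat (card ?L) * (2 ^ N * D))"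
    have "cmod (T (\<lambda>x. g x * \<theta> x)) \<le> ?B * b"
      if g: "bounded_derivs g" and b: "b \<ge> 0"
        and gb: "\<forall>\<gamma>. \<forall>x\<in>S. length \<gamma> \<le> N \<longrightarrow> cmod (partial_derivs \<gamma> g x) \<le> b * (1 + norm x)" for g b
    proof -
      let ?\<phi> = "\<lambda>x. g x * \<theta> x"
      have \<phi>: "?\<phi> \<in> schwartz_space" using g \<theta> by (rule schwartz_space_mult)
      have le: "(1 + norm x) ^ N * cmod (partial_derivs \<beta> ?\<phi> x) \<le> 2 ^ N * D * b" if "\<beta> \<in> ?L" for x \<beta>
      proof (cases "x \<in> S")
        case True
        have pos: "1 + norm x > 0" by (simp add: add_pos_nonneg)
        have "cmod (partial_derivs \<beta> ?\<phi> x) \<le> 2 ^ N * ((b * (1 + norm x)) * (D / (1 + norm x) ^ Suc N))"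
          using g \<theta> gb b D that True
          by (intro leibniz_bound[where N = N]) (auto simp: bounded_derivs_def schwartz_space_iff)
        also have "\<dots> = 2 ^ N * D * b / (1 + norm x) ^ N"
          using pos by simp
        finally show ?thesis using pos by (simp add: pos_le_divide_eq mult.commute)
      next
        case False
        have "partial_derivs \<beta> ?\<phi> x = 0"
          by (rule partial_derivs_eq_0_on_open[where U = "- S"]) (use S False in auto)
        then show ?thesis using b D by simp
      qed
      have "schwartz_seminorm N ?\<phi> \<le> of_nat (card ?L) * (2 ^ N * D * b)"
        unfolding schwartz_seminorm_def by (intro sum_bounded_above cSUP_least le) auto
      moreover have "schwartz_seminorm N ?\<phi> \<ge> 0"
        unfolding schwartz_seminorm_def
      proof (intro sum_nonneg)
        fix \<beta> assume "\<beta> \<in> ?L"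
        then have "bdd_above (range (\<lambda>x. (1 + norm x) ^ N * cmod (partial_derivs \<beta> ?\<phi> x)))"
          using le by (intro bdd_aboveI2) blast
        from cSUP_upper[OF _ this, of 0]
        show "0 \<le> (SUP x. (1 + norm x) ^ N * cmod (partial_derivs \<beta> ?\<phi> x))" by (simp add: order_trans[rotated])
      qed
      ultimately have "\<bar>C0\<bar> * schwartz_seminorm N ?\<phi> \<le> ?B * b"
        by (simp add: mult_left_mono mult.assoc)
      moreover have "cmod (T ?\<phi>) \<le> \<bar>C0\<bar> * schwartz_seminorm N ?\<phi>"
        using CN \<phi> \<open>schwartz_seminorm N ?\<phi> \<ge> 0\<close> by (meson abs_ge_self mult_right_mono order_trans)
      ultimately show ?thesis by linarith
    qed
    then show "\<exists>B. multiplier_bound T N \<theta> S B" unfolding multiplier_bound_def by blast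
  qed
  then show ?thesis ..
qed

section \<open>Polynomials, Gaussians and cutoff functions\<close>

definition coordinate_funs :: "(real^'n::finite \<Rightarrow> complex) set" where
  "coordinate_funs = range (\<lambda>i x. of_real (x $ i))"

definition polynomial_funs :: "(real^'n::finite \<Rightarrow> complex) set" where
  "polynomial_funs = fun_ring coordinate_funs"

lemma coordinate_partial_deriv:
  assumes "f \<in> coordinate_funs"
  shows "(\<forall>x. f differentiable (at x)) \<and> (\<forall>j. partial_deriv j f \<in> polynomial_funs)"
proof -
  obtain i where f: "f = (\<lambda>x. complex_of_real (x $ i))" using assms by (auto simp: coordinate_funs_def)
  have d: "(f has_derivative (\<lambda>h. of_real (h $ i))) (at x)" for x
    unfolding f by (intro bounded_linear_imp_has_derivative bounded_linear_compose[OF bounded_linear_of_real] bounded_linear_vec_nth)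
  then have "partial_deriv j f = (\<lambda>x. of_real (axis j 1 $ i))" for j
    using partial_derivI by blast
  then show ?thesis
    using d unfolding differentiable_def polynomial_funs_def by (auto intro: fun_ring.const)
qed

lemma polynomial_funs_smooth: "p \<in> polynomial_funs \<Longrightarrow> smooth_fun p"
  and polynomial_funs_partial_deriv: "p \<in> polynomial_funs \<Longrightarrow> partial_deriv i p \<in> polynomial_funs"
  unfolding polynomial_funs_def
  using fun_ring_smooth[of coordinate_funs]
    fun_ring_partial_deriv[of coordinate_funs]
    coordinate_partial_deriv[unfolded polynomial_funs_def] by blast+

lemma polynomial_funs_const: "(\<lambda>x. c) \<in> polynomial_funs"
  and polynomial_funs_add: "p \<in> polynomial_funs \<Longrightarrow> q \<in> polynomial_funs \<Longrightarrow> (\<lambda>x. p x + q x) \<in> polynomial_funs"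
  and polynomial_funs_mult: "p \<in> polynomial_funs \<Longrightarrow> q \<in> polynomial_funs \<Longrightarrow> (\<lambda>x. p x * q x) \<in> polynomial_funs"
  and polynomial_funs_coordinate: "(\<lambda>x. of_real (x $ i)) \<in> polynomial_funs"
  unfolding polynomial_funs_def by (auto intro: fun_ring.intros simp: coordinate_funs_def)

lemma polynomial_funs_sum:
  assumes "finite A" "\<And>a. a \<in> A \<Longrightarrow> p a \<in> polynomial_funs"
  shows "(\<lambda>x. \<Sum>a\<in>A. p a x) \<in> polynomial_funs"
  using assms by (induction A) (auto intro: polynomial_funs_const polynomial_funs_add)

lemma polynomial_funs_inner: "(\<lambda>x. of_real (u \<bullet> x)) \<in> polynomial_funs"
  unfolding inner_vec_def of_real_sum inner_real_def of_real_mult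
  by (intro polynomial_funs_sum polynomial_funs_mult polynomial_funs_const polynomial_funs_coordinate) auto

lemma polynomial_funs_norm_square: "(\<lambda>x. of_real ((norm x)\<^sup>2)) \<in> polynomial_funs"
  unfolding power2_norm_eq_inner inner_vec_def of_real_sum inner_real_def of_real_mult
  by (intro polynomial_funs_sum polynomial_funs_mult polynomial_funs_const polynomial_funs_coordinate) auto

lemma polynomial_funs_growth:
  assumes "p \<in> polynomial_funs"
  shows "\<exists>C k. 0 \<le> C \<and> (\<forall>x. cmod (p x) \<le> C * (1 + norm x) ^ k)"
  using assms unfolding polynomial_funs_def
proof induction
  case (base f)
  then obtain i where f: "f = (\<lambda>x. complex_of_real (x $ i))" by (auto simp: coordinate_funs_def)
  have "cmod (f x) \<le> 1 * (1 + norm x) ^ 1" for x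
    using component_le_norm_cart[of x i] by (simp add: f)
  then show ?case by (metis zero_le_one)
next
  case (const c)
  have "\<forall>x::real^'a. cmod c \<le> cmod c * (1 + norm x) ^ 0" by simp
  then show ?case by (metis norm_ge_zero)
next
  case (add f g)
  then obtain C k D l where C: "0 \<le> C" "\<And>x. cmod (f x) \<le> C * (1 + norm x) ^ k"
    and D: "0 \<le> D" "\<And>x. cmod (g x) \<le> D * (1 + norm x) ^ l" by blast
  have "cmod (f x + g x) \<le> (C + D) * (1 + norm x) ^ (k + l)" for x
  proof -
    have "C * (1 + norm x) ^ k \<le> C * (1 + norm x) ^ (k + l)" "D * (1 + norm x) ^ l \<le> D * (1 + norm x) ^ (k + l)"
      using C D by (auto intro!: mult_left_mono power_increasing)
    then show ?thesis
      using norm_triangle_ineq[of "f x" "g x"] C(2)[of x] D(2)[of x] by (simp add: distrib_right)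
  qed
  then show ?case using C D by (metis add_nonneg_nonneg)
next
  case (mult f g)
  then obtain C k D l where C: "0 \<le> C" "\<And>x. cmod (f x) \<le> C * (1 + norm x) ^ k"
    and D: "0 \<le> D" "\<And>x. cmod (g x) \<le> D * (1 + norm x) ^ l" by blast
  have "cmod (f x * g x) \<le> (C * D) * (1 + norm x) ^ (k + l)" for x
    using mult_mono[OF C(2)[of x] D(2)[of x]] C(1) by (simp add: norm_mult power_add mult_ac)
  then show ?case using C D by (metis mult_nonneg_nonneg)
qed

lemma partial_derivs_polynomial_exp:
  assumes "p \<in> polynomial_funs" "q \<in> polynomial_funs"
  shows "\<exists>r\<in>polynomial_funs. partial_derivs \<beta> (\<lambda>x. p x * exp (q x)) = (\<lambda>x. r x * exp (q x))"
proof (induction \<beta>)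
  case Nil
  then show ?case using assms by auto
next
  case (Cons i \<beta>)
  then obtain r where r: "r \<in> polynomial_funs" "partial_derivs \<beta> (\<lambda>x. p x * exp (q x)) = (\<lambda>x. r x * exp (q x))"
    by blast
  have "partial_deriv i (\<lambda>x. exp (q x)) x = exp (q x) * partial_deriv i q x" for x
    by (intro partial_deriv_chain(2) DERIV_exp smooth_fun_differentiable polynomial_funs_smooth assms(2))
  then have "partial_deriv i (\<lambda>x. exp (q x)) = (\<lambda>x. exp (q x) * partial_deriv i q x)" by blast
  then have "partial_derivs (i # \<beta>) (\<lambda>x. p x * exp (q x)) = (\<lambda>x. (partial_deriv i r x + r x * partial_deriv i q x) * exp (q x))"
    using r assms by (simp add: partial_deriv_mult_smooth smooth_fun_exp polynomial_funs_smooth algebra_simps)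
  moreover have "(\<lambda>x. partial_deriv i r x + r x * partial_deriv i q x) \<in> polynomial_funs"
    using r assms by (intro polynomial_funs_add polynomial_funs_mult polynomial_funs_partial_deriv)
  ultimately show ?case by (intro bexI)
qed

text \<open>
All partial derivatives of $p\,e^q$ have the form $r\,e^q$ with a polynomial \<open>r\<close>, and
the Gaussian decay of $e^q$ beats polynomial growth: $(1+|x|)^m \le m!\,e^{1+|x|}$ and
$|x| \le c|x|^2 + 1/(4c)$.
\<close>
lemma polynomial_exp_schwartz:
  fixes p q :: "real^'n::finite \<Rightarrow> complex"
  assumes pq: "p \<in> polynomial_funs" "q \<in> polynomial_funs"
    and "c > 0" and q: "\<And>x. Re (q x) \<le> C - c * (norm x)\<^sup>2"
  shows "(\<lambda>x. p x * exp (q x)) \<in> schwartz_space"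
  unfolding schwartz_space_iff
proof (intro conjI allI)
  show "smooth_fun (\<lambda>x. p x * exp (q x))"
    using pq by (intro smooth_fun_mult smooth_fun_exp polynomial_funs_smooth)
  fix N and \<beta> :: "'n list"
  obtain r where r: "r \<in> polynomial_funs" "partial_derivs \<beta> (\<lambda>x. p x * exp (q x)) = (\<lambda>x. r x * exp (q x))"
    using partial_derivs_polynomial_exp[OF pq] by blast
  obtain D k where D: "0 \<le> D" "\<And>x. cmod (r x) \<le> D * (1 + norm x) ^ k"
    using polynomial_funs_growth[OF r(1)] by blast
  have "(1 + norm x) ^ N * cmod (partial_derivs \<beta> (\<lambda>x. p x * exp (q x)) x)
     \<le> D * fact (N + k) * exp (1 + C + 1 / (4 * c))" for x
  proof -
    have "(1 + norm x) ^ (N + k) \<le> fact (N + k) * exp (1 + norm x)"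
    proof -
      have "(1 + norm x) ^ (N + k) / fact (N + k) \<le> exp (1 + norm x)"
        using sum_le_suminf[OF summable_exp_generic[of "1 + norm x"], of "{N + k}"]
        by (simp add: exp_def divide_inverse mult.commute)
      then show ?thesis by (simp add: field_simps)
    qed
    have "0 \<le> (2 * c * norm x - 1)\<^sup>2" by simp
    then have "norm x \<le> c * (norm x)\<^sup>2 + 1 / (4 * c)"
      using \<open>c > 0\<close> by (simp add: field_simps power2_eq_square)
    then have "1 + norm x + Re (q x) \<le> 1 + C + 1 / (4 * c)"
      using q[of x] by linarith
    then have e: "exp (1 + norm x) * exp (Re (q x)) \<le> exp (1 + C + 1 / (4 * c))"
      by (simp flip: exp_add)
    have "(1 + norm x) ^ N * cmod (partial_derivs \<beta> (\<lambda>x. p x * exp (q x)) x)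
       = (1 + norm x) ^ N * (cmod (r x) * exp (Re (q x)))"
      by (simp add: r norm_mult norm_exp_eq_Re)
    also have "\<dots> \<le> (1 + norm x) ^ N * ((D * (1 + norm x) ^ k) * exp (Re (q x)))"
      by (intro mult_left_mono mult_right_mono D) auto
    also have "\<dots> = D * ((1 + norm x) ^ (N + k) * exp (Re (q x)))" by (simp add: power_add)
    also have "\<dots> \<le> D * ((fact (N + k) * exp (1 + norm x)) * exp (Re (q x)))"
      by (intro mult_left_mono mult_right_mono D) (fact | simp)+
    also have "\<dots> = D * fact (N + k) * (exp (1 + norm x) * exp (Re (q x)))" by simp
    also have "\<dots> \<le> D * fact (N + k) * exp (1 + C + 1 / (4 * c))"
      using D e by (intro mult_left_mono) auto
    finally show ?thesis .
  qed
  then show "\<exists>C. \<forall>x. (1 + norm x) ^ N * cmod (partial_derivs \<beta> (\<lambda>x. p x * exp (q x)) x) \<le> C" by blast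
qed

text \<open>
The quotient $F(b-q)/(F(b-q)+F(q-a))$ with $F(t) = e^{-1/t}$ for $t > 0$ and $F(t)=0$ otherwise;
the denominator never vanishes because $a < b$.
\<close>
lemma smooth_cutoff:
  fixes q :: "real^'n::finite \<Rightarrow> real"
  assumes q: "smooth_fun (\<lambda>x. complex_of_real (q x))" and "a < b"
  obtains \<eta> where "smooth_fun \<eta>" "\<And>x. q x \<le> a \<Longrightarrow> \<eta> x = 1" "\<And>x. b \<le> q x \<Longrightarrow> \<eta> x = 0"
proof -
  define F where "F = flat_exp 0"
  have F: "F t > 0" if "t > 0" for t using that by (simp add: F_def flat_exp_def)
  have F0: "F t = 0" if "t \<le> 0" for t using that by (simp add: F_def flat_exp_def)
  have Fn: "F t \<ge> 0" for t by (simp add: F_def flat_exp_def)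
  have sm: "smooth_fun (\<lambda>x. complex_of_real (F (b - q x)))" "smooth_fun (\<lambda>x. complex_of_real (F (q x - a)))"
    unfolding F_def using q
    by (auto intro!: smooth_fun_flat_exp smooth_fun_minus smooth_fun_const)
  have pos: "F (b - q x) + F (q x - a) > 0" for x
    using F[of "b - q x"] F[of "q x - a"] Fn[of "b - q x"] Fn[of "q x - a"] \<open>a < b\<close>
    by (cases "q x < b") (auto intro: add_pos_nonneg add_nonneg_pos)
  let ?\<eta> = "\<lambda>x. complex_of_real (F (b - q x)) * inverse (complex_of_real (F (b - q x)) + complex_of_real (F (q x - a)))"
  have nz: "complex_of_real (F (b - q x)) + complex_of_real (F (q x - a)) \<noteq> 0" for x
    using pos[of x] by (metis of_real_add of_real_eq_0_iff less_irrefl)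
  show thesis
  proof (rule that[of ?\<eta>])
    show "smooth_fun ?\<eta>"
      using nz by (intro smooth_fun_mult smooth_fun_inverse smooth_fun_add sm) auto
    show "?\<eta> x = 1" if "q x \<le> a" for x
      using that F0[of "q x - a"] nz[of x] by simp
    show "?\<eta> x = 0" if "b \<le> q x" for x
      using that F0[of "b - q x"] by simp
  qed
qed

text \<open>
The definition of support only speaks about test functions of compact support. A Schwartz function
that vanishes near \<open>K\<close> is reached from these by cutting it off at radius
\<open>R\<close>: what is cut away has the multiplier $1-\eta(x/R)$, which is of size $O(1/R)$ in
the weighted sense of \<open>multiplier_bound\<close>.
\<close>
lemma distribution_vanish_off_support:
  fixes K V :: "(real^'n::finite) set"
  assumes T: "tempered_distribution T" and supp: "supported_by T K"
    and V: "open V" "K \<subseteq> V" and \<theta>: "\<theta> \<in> schwartz_space" and \<theta>V: "\<And>x. x \<in> V \<Longrightarrow> \<theta> x = 0"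
  shows "T \<theta> = 0"
proof -
  have "smooth_fun (\<lambda>x::real^'n. complex_of_real ((norm x)\<^sup>2))"
    using polynomial_funs_norm_square polynomial_funs_smooth by blast
  then obtain \<eta> :: "real^'n \<Rightarrow> complex"
    where \<eta>: "smooth_fun \<eta>" "\<And>x. (norm x)\<^sup>2 \<le> 1 \<Longrightarrow> \<eta> x = 1" "\<And>x. 4 \<le> (norm x)\<^sup>2 \<Longrightarrow> \<eta> x = 0"
    using smooth_cutoff[of "\<lambda>x. (norm x)\<^sup>2" 1 4] by auto
  have \<eta>0: "\<eta> x = 0" if "norm x > 2" for x
    using that power_mono[of 2 "norm x" 2] by (intro \<eta>(3)) auto
  have bd\<eta>: "bounded_derivs \<eta>"
    using \<eta>(1) \<eta>0 by (rule smooth_compact_support_bounded_derivs)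
  define g where "g = (\<lambda>x. 1 - \<eta> x)"
  have bdg: "bounded_derivs g" unfolding g_def using bd\<eta> by (rule bounded_derivs_one_minus)
  then have smg: "smooth_fun g" by (simp add: bounded_derivs_def)
  obtain N where N: "distribution_order T N"
    using tempered_distribution_order[OF T] ..
  obtain B where B: "multiplier_bound T N \<theta> UNIV B"
    using N \<theta> unfolding distribution_order_def by blast
  obtain C where C: "C \<ge> 0" "\<And>\<gamma> x. length \<gamma> \<le> N \<Longrightarrow> cmod (partial_derivs \<gamma> g x) \<le> C"
    using bounded_derivs_uniform[OF bdg] by metis
  have bound: "cmod (T \<theta>) \<le> B * (C / R)" if R: "R \<ge> 1" for R
  proof -
    define gR where "gR = (\<lambda>x. g ((1 / R) *\<^sub>R x))"
    \<comment> \<open>Rescaling by $R \ge 1$ only shrinks derivatives.\<close>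
    have dg: "partial_derivs \<gamma> gR = (\<lambda>x. of_real ((1 / R) ^ length \<gamma>) * partial_derivs \<gamma> g ((1 / R) *\<^sub>R x))" for \<gamma>
      by (simp only: gR_def partial_derivs_scale[OF smg])
    have smgR: "smooth_fun gR"
      unfolding smooth_fun_def
    proof (intro allI)
      fix \<gamma> and x :: "real^'n"
      have sc: "((\<lambda>x. (1 / R) *\<^sub>R x) has_derivative (\<lambda>h. (1 / R) *\<^sub>R h)) (at x)"
        by (auto intro!: derivative_eq_intros)
      have g: "(partial_derivs \<gamma> g has_derivative
          frechet_derivative (partial_derivs \<gamma> g) (at ((1 / R) *\<^sub>R x))) (at ((1 / R) *\<^sub>R x))"
        using smg smooth_fun_partial_derivs smooth_fun_has_derivative by blast
      have "(\<lambda>x. partial_derivs \<gamma> g ((1 / R) *\<^sub>R x)) differentiable (at x)"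
        using has_derivative_compose[OF sc g] unfolding differentiable_def by blast
      then show "partial_derivs \<gamma> gR differentiable (at x)"
        unfolding dg by (intro differentiable_mult) auto
    qed
    have le: "cmod (partial_derivs \<gamma> gR x) \<le> cmod (partial_derivs \<gamma> g ((1 / R) *\<^sub>R x))" for \<gamma> x
    proof -
      have "(1 / R) ^ length \<gamma> \<le> 1" using R by (intro power_le_one) auto
      then show ?thesis using R
        by (simp add: dg norm_mult norm_power norm_divide mult_left_le_one_le del: power_divide)
    qed
    have bdgR: "bounded_derivs gR"
      unfolding bounded_derivs_def
    proof (intro conjI allI smgR)
      fix \<gamma>
      obtain D where "\<And>x. cmod (partial_derivs \<gamma> g x) \<le> D"
        using bdg unfolding bounded_derivs_def by blast
      then show "\<exists>D. \<forall>x. cmod (partial_derivs \<gamma> gR x) \<le> D"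
        using le order_trans by blast
    qed
    have "cmod (T (\<lambda>x. gR x * \<theta> x)) \<le> B * (C / R)"
    proof (rule multiplier_boundD[OF B bdgR])
      show "0 \<le> C / R" using C R by simp
      fix \<gamma> :: "'n list" and x :: "real^'n"
      assume \<gamma>: "length \<gamma> \<le> N"
      show "cmod (partial_derivs \<gamma> gR x) \<le> C / R * (1 + norm x)"
      proof (cases "norm x < R")
        case True
        have "gR y = 0" if "y \<in> ball 0 R" for y
          using that R \<eta>(2)[of "(1 / R) *\<^sub>R y"] by (simp add: gR_def g_def power_le_one)
        then have "partial_derivs \<gamma> gR x = 0"
          by (intro partial_derivs_eq_0_on_open[where U = "ball 0 R"]) (use True in auto)
        then show ?thesis using C R by simp
      next
        case False
        have "cmod (partial_derivs \<gamma> gR x) \<le> C" using le C(2)[OF \<gamma>] order_trans by blast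
        also have "C \<le> C / R * (1 + norm x)"
        proof -
          have "C * R \<le> C * (1 + norm x)" using False C by (intro mult_left_mono) auto
          then show ?thesis using R by (simp add: field_simps)
        qed
        finally show ?thesis .
      qed
    qed
    moreover have "T \<theta> = T (\<lambda>x. gR x * \<theta> x)"
    proof -
      let ?\<kappa> = "\<lambda>x. (1 - gR x) * \<theta> x"
      have \<kappa>: "?\<kappa> \<in> schwartz_space"
        using bdgR \<theta> by (intro schwartz_space_mult bounded_derivs_one_minus)
      have "{x. ?\<kappa> x \<noteq> 0} \<subseteq> cball 0 (2 * R) - V"
      proof
        fix x assume x: "x \<in> {x. ?\<kappa> x \<noteq> 0}"
        then have "\<eta> ((1 / R) *\<^sub>R x) \<noteq> 0" "x \<notin> V" using \<theta>V by (auto simp: gR_def g_def)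
        then show "x \<in> cball 0 (2 * R) - V" using \<eta>0[of "(1 / R) *\<^sub>R x"] R by (force simp: field_simps)
      qed
      moreover have cl: "closed (cball 0 (2 * R) - V)" using V by (intro closed_Diff) auto
      ultimately have sub: "closure {x. ?\<kappa> x \<noteq> 0} \<subseteq> cball 0 (2 * R) - V"
        by (rule closure_minimal)
      then have "compact (closure {x. ?\<kappa> x \<noteq> 0})"
        by (meson bounded_cball bounded_subset closed_closure compact_eq_bounded_closed Diff_subset)
      moreover have "closure {x. ?\<kappa> x \<noteq> 0} \<inter> K = {}" using sub V by auto
      ultimately have "T ?\<kappa> = 0"
        using supp \<kappa> unfolding supported_by_def schwartz_space_iff by blast
      moreover have "T (\<lambda>x. gR x * \<theta> x + ?\<kappa> x) = T (\<lambda>x. gR x * \<theta> x) + T ?\<kappa>"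
        using T schwartz_space_mult[OF bdgR \<theta>] \<kappa> by (rule tempered_distribution_add)
      ultimately show ?thesis by (simp add: algebra_simps)
    qed
    ultimately show ?thesis by simp
  qed
  have "((\<lambda>R. B * (C / R)) \<longlongrightarrow> 0) at_top"
    by (intro tendsto_mult_right_zero tendsto_divide_0[OF tendsto_const] filterlim_ident filterlim_at_top_imp_at_infinity)
  moreover have "\<forall>\<^sub>F R in at_top. cmod (T \<theta>) \<le> B * (C / R)"
    using eventually_ge_at_top[of 1] by eventually_elim (rule bound)
  ultimately have "cmod (T \<theta>) \<le> 0"
    by (rule tendsto_lowerbound) simp
  then show ?thesis by simp
qed

section \<open>An interpolation formula with extremal signs\<close>

lemma norm_sin_le_exp_Im: "norm (sin z) \<le> exp \<bar>Im z\<bar>" for z :: complex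
proof -
  have "norm (sin z) = norm (exp (\<i> * z) - exp (- (\<i> * z))) / 2"
    by (simp add: sin_exp_eq norm_divide norm_mult)
  also have "\<dots> \<le> (norm (exp (\<i> * z)) + norm (exp (- (\<i> * z)))) / 2"
    by (intro divide_right_mono norm_triangle_ineq4) auto
  also have "\<dots> \<le> (exp \<bar>Im z\<bar> + exp \<bar>Im z\<bar>) / 2"
    by (intro divide_right_mono add_mono) (auto simp: norm_exp_eq_Re)
  finally show ?thesis by simp
qed

lemma norm_cos_le_exp_Im: "norm (cos z) \<le> exp \<bar>Im z\<bar>" for z :: complex
proof -
  have "norm (cos z) = norm (exp (\<i> * z) + exp (- (\<i> * z))) / 2"
    by (simp add: cos_exp_eq norm_divide norm_mult)
  also have "\<dots> \<le> (norm (exp (\<i> * z)) + norm (exp (- (\<i> * z)))) / 2"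
    by (intro divide_right_mono norm_triangle_ineq) auto
  also have "\<dots> \<le> (exp \<bar>Im z\<bar> + exp \<bar>Im z\<bar>) / 2"
    by (intro divide_right_mono add_mono) (auto simp: norm_exp_eq_Re)
  finally show ?thesis by simp
qed

text \<open>
The hypothesis describes the sides of the contours below: the vertical ones pass midway between two
zeros of the sine, the horizontal ones stay away from the real axis.
\<close>
lemma norm_sin_ge_exp_Im:
  fixes z :: complex
  assumes "cos (2 * Re z) = - 1 \<or> \<bar>Im z\<bar> \<ge> 1"
  shows "exp \<bar>Im z\<bar> / 4 \<le> norm (sin z)"
proof -
  define E where "E = exp (2 * \<bar>Im z\<bar>)"
  have E: "exp (2 * Im z) + inverse (exp (2 * Im z)) = E + inverse E"
    by (cases "Im z \<ge> 0") (auto simp: E_def exp_minus)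
  have "E > 0" by (simp add: E_def)
  have "E / 16 \<le> (E + inverse E - 2 * cos (2 * Re z)) / 4"
    using assms
  proof
    assume "cos (2 * Re z) = - 1"
    moreover have "inverse E > 0" using \<open>E > 0\<close> by simp
    ultimately show ?thesis using \<open>E > 0\<close> by argo
  next
    assume "\<bar>Im z\<bar> \<ge> 1"
    have "1 + 2 * \<bar>Im z\<bar> \<le> E" unfolding E_def by (rule exp_ge_add_one_self)
    then have "E \<ge> 3" using \<open>\<bar>Im z\<bar> \<ge> 1\<close> by linarith
    moreover have "inverse E > 0" using \<open>E > 0\<close> by simp
    moreover have "cos (2 * Re z) \<le> 1" by simp
    ultimately show ?thesis by argo
  qed
  also have "\<dots> = (norm (sin z))\<^sup>2" unfolding norm_sin_squared E ..
  finally have "(exp \<bar>Im z\<bar> / 4)\<^sup>2 \<le> (norm (sin z))\<^sup>2"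
    by (simp add: E_def power_divide flip: exp_double)
  then show ?thesis by (rule power2_le_imp_le) simp
qed

lemma norm_contour_integral_rectpath_le:
  assumes cont: "continuous_on (path_image (rectpath a b)) f"
    and "0 \<le> B" and B: "\<And>z. z \<in> path_image (rectpath a b) \<Longrightarrow> norm (f z) \<le> B"
  shows "norm (contour_integral (rectpath a b) f) \<le> B * (2 * \<bar>Re b - Re a\<bar> + 2 * \<bar>Im b - Im a\<bar>)"
proof -
  define c d where "c = Complex (Re b) (Im a)" and "d = Complex (Re a) (Im b)"
  have im: "path_image (rectpath a b) =
      closed_segment a c \<union> closed_segment c b \<union> closed_segment b d \<union> closed_segment d a"
    by (simp add: rectpath_def Let_def path_image_join c_def d_def Un_assoc)
  have int: "f contour_integrable_on linepath u v"
    if "closed_segment u v \<subseteq> path_image (rectpath a b)" for u v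
    by (rule contour_integrable_continuous_linepath, rule continuous_on_subset[OF cont that])
  have bound: "norm (contour_integral (linepath u v) f) \<le> B * norm (v - u)"
    if "closed_segment u v \<subseteq> path_image (rectpath a b)" for u v
    by (rule contour_integral_bound_linepath[OF int[OF that] \<open>0 \<le> B\<close>]) (rule B, rule subsetD[OF that])
  have segs: "closed_segment a c \<subseteq> path_image (rectpath a b)" "closed_segment c b \<subseteq> path_image (rectpath a b)"
    "closed_segment b d \<subseteq> path_image (rectpath a b)" "closed_segment d a \<subseteq> path_image (rectpath a b)"
    unfolding im by blast+
  have len: "norm (c - a) = \<bar>Re b - Re a\<bar>" "norm (b - c) = \<bar>Im b - Im a\<bar>"
    "norm (d - b) = \<bar>Re b - Re a\<bar>" "norm (a - d) = \<bar>Im b - Im a\<bar>"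
    by (simp_all add: c_def d_def cmod_def)
  have j1: "f contour_integrable_on linepath b d +++ linepath d a"
    using int segs by (intro contour_integrable_joinI) auto
  have j2: "f contour_integrable_on linepath c b +++ linepath b d +++ linepath d a"
    by (intro contour_integrable_joinI int segs j1 valid_path_join valid_path_linepath) auto
  have "contour_integral (rectpath a b) f = contour_integral (linepath a c) f +
    (contour_integral (linepath c b) f + (contour_integral (linepath b d) f + contour_integral (linepath d a) f))"
    unfolding rectpath_def Let_def c_def[symmetric] d_def[symmetric]
    using j1 j2 int segs by simp
  also have "norm \<dots> \<le> B * norm (c - a) + (B * norm (b - c) + (B * norm (d - b) + B * norm (a - d)))"
    by (intro norm_triangle_mono bound segs)
  finally show ?thesis unfolding len by (simp add: algebra_simps)
qed

text \<open>
The zeros of $\sin(z+\epsilon)$.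
\<close>
definition sampling_node :: "real \<Rightarrow> int \<Rightarrow> real" where
  "sampling_node \<epsilon> n = of_int n * pi - \<epsilon>"

definition interp_nodes :: "real \<Rightarrow> real \<Rightarrow> nat \<Rightarrow> real set" where
  "interp_nodes \<epsilon> s P = insert 0 (insert s (sampling_node \<epsilon> ` {- int P..int P}))"

text \<open>
Up to the factor $-s$, the weight at \<open>\<tau>\<close> is the residue of
$1/(z(z-s)\sin(z+\epsilon))$; at a zero of the sine the factor $1/\cos(\tau+\epsilon)$ of the
residue is written as $\cos(\tau+\epsilon)$, since it is $\pm 1$ there.
\<close>
definition interp_weight :: "real \<Rightarrow> real \<Rightarrow> real \<Rightarrow> real" where
  "interp_weight \<epsilon> s \<tau> =
    (if \<tau> = 0 then 1 / sin \<epsilon> else if \<tau> = s then - 1 / sin (s + \<epsilon>)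
     else - s * cos (\<tau> + \<epsilon>) / (\<tau> * (\<tau> - s)))"

text \<open>
No zero of $\sin(z+\epsilon)$ lies between the two nodes $0$ and \<open>s\<close>. Hence
$\tau(\tau-s) > 0$ at all zeros, and the sign of the weight there is that of
$-\cos(\tau+\epsilon)$.
\<close>
lemma sampling_node_not_between:
  assumes "0 < \<epsilon>" "0 \<le> s" "s + \<epsilon> < pi"
  shows "sampling_node \<epsilon> n < 0 \<or> sampling_node \<epsilon> n > s"
proof (cases "n \<le> 0")
  case True
  then have "of_int n * pi \<le> 0" by (simp add: mult_nonpos_nonneg)
  then show ?thesis using assms by (simp add: sampling_node_def)
next
  case False
  then have "1 * pi \<le> of_int n * pi" by (intro mult_right_mono) auto
  then show ?thesis using assms unfolding sampling_node_def by linarith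
qed

lemma inj_sampling_node: "inj (sampling_node \<epsilon>)"
  by (auto simp: inj_def sampling_node_def)

lemma cos_int_pi_sampling: "cos (sampling_node \<epsilon> n + \<epsilon>) \<in> {- 1, 1}"
  using cos_npi_int[of n] by (auto simp: sampling_node_def mult.commute)

lemma sum_interp_nodes:
  fixes f :: "real \<Rightarrow> 'a::ab_group_add"
  assumes "0 < \<epsilon>" "0 < s" "s + \<epsilon> < pi"
  shows "(\<Sum>\<tau>\<in>interp_nodes \<epsilon> s P. f \<tau>) = f 0 + f s + (\<Sum>n\<in>{- int P..int P}. f (sampling_node \<epsilon> n))"
proof -
  have "0 \<notin> sampling_node \<epsilon> ` {- int P..int P}" "s \<notin> sampling_node \<epsilon> ` {- int P..int P}"
    using sampling_node_not_between[of \<epsilon> s] assms by (metis imageE less_irrefl less_imp_le not_less_iff_gr_or_eq order_less_trans)+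
  moreover have "sum f (sampling_node \<epsilon> ` {- int P..int P}) = (\<Sum>n\<in>{- int P..int P}. f (sampling_node \<epsilon> n))"
    by (subst sum.reindex) (auto intro: inj_on_subset[OF inj_sampling_node])
  ultimately show ?thesis
    using assms by (simp add: interp_nodes_def add.assoc)
qed

lemma interp_kernel_residue:
  assumes es: "0 < \<epsilon>" "0 < s" "s + \<epsilon> < pi" and G: "G holomorphic_on UNIV"
    and S: "open S" "complex_of_real \<tau> \<in> S"
    and \<tau>: "\<tau> \<in> interp_nodes \<epsilon> s P"
    and holo: "(\<lambda>z. G z / (z * (z - of_real s) * sin (z + of_real \<epsilon>))) holomorphic_on S - {of_real \<tau>}"
  shows "- of_real s * residue (\<lambda>z. G z / (z * (z - of_real s) * sin (z + of_real \<epsilon>))) (of_real \<tau>)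
    = of_real (interp_weight \<epsilon> s \<tau>) * G (of_real \<tau>)"
proof -
  let ?F = "\<lambda>z. G z / (z * (z - of_real s) * sin (z + of_real \<epsilon>))"
  have cG: "isCont G z" for z
    using G by (meson UNIV_I continuous_on_eq_continuous_at holomorphic_on_imp_continuous_on open_UNIV)
  have sn: "sin (complex_of_real \<epsilon>) \<noteq> 0" "sin (complex_of_real s + complex_of_real \<epsilon>) \<noteq> 0"
  proof -
    have "sin \<epsilon> > 0" "sin (s + \<epsilon>) > 0" using es by (auto intro!: sin_gt_zero)
    then show "sin (complex_of_real \<epsilon>) \<noteq> 0" "sin (complex_of_real s + complex_of_real \<epsilon>) \<noteq> 0"
      by (simp_all add: sin_of_real flip: of_real_add)
  qed
  note res = residue_simple'[OF S holo]
  \<comment> \<open>All poles are simple, so each residue is the limit of $(z-\tau)F(z)$.\<close>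
  consider "\<tau> = 0" | "\<tau> = s" | "\<tau> \<noteq> 0" "\<tau> \<noteq> s" "\<exists>n. \<tau> = sampling_node \<epsilon> n"
    using \<tau> by (auto simp: interp_nodes_def)
  then show ?thesis
  proof cases
    case 1
    have "((\<lambda>z. G z / ((z - of_real s) * sin (z + of_real \<epsilon>))) \<longlongrightarrow>
       G 0 / ((0 - of_real s) * sin (0 + of_real \<epsilon>))) (at 0)"
      using es sn by (intro tendsto_intros isContD[OF cG]) auto
    then have "((\<lambda>z. ?F z * (z - of_real \<tau>)) \<longlongrightarrow> G 0 / ((0 - of_real s) * sin (0 + of_real \<epsilon>))) (at (of_real \<tau>))"
      unfolding 1 of_real_0 by (rule Lim_transform_eventually) (auto simp: eventually_at_filter)
    from res[OF this] show ?thesis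
      using es sn by (simp add: 1 interp_weight_def sin_of_real)
  next
    case 2
    have "((\<lambda>z. G z / (z * sin (z + of_real \<epsilon>))) \<longlongrightarrow>
       G (of_real s) / (of_real s * sin (of_real s + of_real \<epsilon>))) (at (of_real s))"
      using es sn by (intro tendsto_intros isContD[OF cG]) auto
    then have "((\<lambda>z. ?F z * (z - of_real \<tau>)) \<longlongrightarrow> G (of_real s) / (of_real s * sin (of_real s + of_real \<epsilon>))) (at (of_real \<tau>))"
      unfolding 2 by (rule Lim_transform_eventually) (auto simp: eventually_at_filter)
    from res[OF this] show ?thesis
      using es sn by (simp add: 2 interp_weight_def sin_of_real flip: of_real_add)
  next
    case 3
    then obtain n where n: "\<tau> = sampling_node \<epsilon> n" by blast
    define c where "c = cos (\<tau> + \<epsilon>)"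
    have c: "c = 1 \<or> c = - 1" using cos_int_pi_sampling[of \<epsilon> n] by (auto simp: c_def n)
    have "sin (\<tau> + \<epsilon>) = 0" by (simp add: n sampling_node_def sin_npi_int mult.commute)
    then have s0: "sin (complex_of_real \<tau> + complex_of_real \<epsilon>) = 0"
      by (simp add: sin_of_real flip: of_real_add)
    have "((\<lambda>z. sin (z + complex_of_real \<epsilon>)) has_field_derivative of_real c) (at (of_real \<tau>))"
      by (auto intro!: derivative_eq_intros simp: c_def cos_of_real simp flip: of_real_add)
    then have "((\<lambda>z. sin (z + complex_of_real \<epsilon>) / (z - of_real \<tau>)) \<longlongrightarrow> of_real c) (at (of_real \<tau>))"
      by (simp add: has_field_derivative_iff s0)
    then have "((\<lambda>z. G z / (z * (z - of_real s)) / (sin (z + of_real \<epsilon>) / (z - of_real \<tau>))) \<longlongrightarrow>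
      G (of_real \<tau>) / (of_real \<tau> * (of_real \<tau> - of_real s)) / of_real c) (at (of_real \<tau>))"
      using 3 c by (intro tendsto_intros isContD[OF cG]) auto
    then have "((\<lambda>z. ?F z * (z - of_real \<tau>)) \<longlongrightarrow>
      G (of_real \<tau>) / (of_real \<tau> * (of_real \<tau> - of_real s)) / of_real c) (at (of_real \<tau>))"
      by (rule Lim_transform_eventually) (auto simp: eventually_at_filter)
    from res[OF this] have "residue ?F (of_real \<tau>) = G (of_real \<tau>) / (of_real \<tau> * (of_real \<tau> - of_real s)) / of_real c" .
    moreover have "interp_weight \<epsilon> s \<tau> = - s * c / (\<tau> * (\<tau> - s))"
      using 3 by (simp add: interp_weight_def c_def)
    ultimately show ?thesis using c by auto
  qed
qed

text \<open>
The residue theorem for $G(z)/(z(z-s)\sin(z+\epsilon))$ on a square whose sides have length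
$(2P+1)\pi$ and pass midway between the poles. There $|\sin(z+\epsilon)|$ is at least a
quarter of $e^{|\mathrm{Im}\,z|}$, which compensates for the growth of \<open>G\<close>, and the
two linear factors leave $O(1/P^2)$ for the integrand, $O(1/P)$ for the integral. The bound depends
on \<open>G\<close> only through \<open>C\<close>, so it is uniform over families of functions.
\<close>
lemma interpolation_error:
  assumes es: "0 < \<epsilon>" "0 < s" "s + \<epsilon> < pi" and G: "G holomorphic_on UNIV" and "C \<ge> 0"
    and growth: "\<And>z. norm z \<ge> 1 \<Longrightarrow> norm (G z) \<le> C * exp \<bar>Im z\<bar>" and "P \<ge> 1"
  shows "norm (\<Sum>\<tau>\<in>interp_nodes \<epsilon> s P. of_real (interp_weight \<epsilon> s \<tau>) * G (of_real \<tau>)) \<le> 96 * s * C / real P"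
proof -
  let ?N = "interp_nodes \<epsilon> s P"
  let ?F = "\<lambda>z. G z / (z * (z - of_real s) * sin (z + of_real \<epsilon>))"
  define L where "L = (real P + 1 / 2) * pi"
  define a b where "a = Complex (- L - \<epsilon>) (- L)" and "b = Complex (L - \<epsilon>) L"
  \<comment> \<open>The square \<open>S\<close> contains the contour with a margin of 1, less than the distance $\pi/2$ to the next pole.\<close>
  define S where "S = box (Complex (- L - 1 - \<epsilon>) (- L - 1)) (Complex (L + 1 - \<epsilon>) (L + 1))"
  define pts where "pts = complex_of_real ` ?N"
  have pi1: "1 * pi \<le> real P * pi" using \<open>P \<ge> 1\<close> by (intro mult_right_mono) auto
  have Lpi: "L = real P * pi + pi / 2" by (simp add: L_def algebra_simps)
  have L: "L > pi" "L > 0" using pi1 pi_gt_zero unfolding Lpi by linarith+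
  have finN: "finite ?N" by (simp add: interp_nodes_def)
  have fin: "finite pts" using finN by (simp add: pts_def)
  have zero_pts: "0 \<in> pts" "of_real s \<in> pts" by (force simp: pts_def interp_nodes_def)+
  have node_bound: "- (real P * pi) \<le> real_of_int n * pi" "real_of_int n * pi \<le> real P * pi"
    if "n \<in> {- int P..int P}" for n
  proof -
    have "- real P \<le> real_of_int n" "real_of_int n \<le> real P" using that by auto
    then have "(- real P) * pi \<le> real_of_int n * pi" "real_of_int n * pi \<le> real P * pi"
      by (intro mult_right_mono; simp)+
    then show "- (real P * pi) \<le> real_of_int n * pi" "real_of_int n * pi \<le> real P * pi" by simp_all
  qed
  have pts_box: "pts \<subseteq> box a b"
  proof
    fix z assume "z \<in> pts"
    then obtain \<tau> where \<tau>: "\<tau> \<in> ?N" "z = of_real \<tau>" by (auto simp: pts_def)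
    consider "\<tau> = 0" | "\<tau> = s" | n where "n \<in> {- int P..int P}" "\<tau> = sampling_node \<epsilon> n"
      using \<tau>(1) unfolding interp_nodes_def by blast
    then have "- L - \<epsilon> < \<tau> \<and> \<tau> < L - \<epsilon>"
    proof cases
      case 3
      then show ?thesis using node_bound[of n] pi_gt_zero unfolding sampling_node_def Lpi by linarith
    qed (use es L in linarith)+
    then show "z \<in> box a b" using L by (auto simp: \<tau> a_def b_def in_box_complex_iff)
  qed
  have cbox_S: "cbox a b \<subseteq> S"
    by (auto simp: S_def a_def b_def in_box_complex_iff in_cbox_complex_iff)
  have le_ab: "Re a \<le> Re b" "Im a \<le> Im b" using L by (simp_all add: a_def b_def)
  have holo: "?F holomorphic_on S - pts"
  proof (intro holomorphic_intros)
    show "G holomorphic_on S - pts" using G holomorphic_on_subset by blast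
    fix z assume z: "z \<in> S - pts"
    have "sin (z + of_real \<epsilon>) \<noteq> 0"
    proof
      assume "sin (z + of_real \<epsilon>) = 0"
      then obtain n :: int where "z + of_real \<epsilon> = of_real (n * pi)" unfolding sin_eq_0 by blast
      then have n: "z = of_real (sampling_node \<epsilon> n)" by (simp add: sampling_node_def algebra_simps)
      have "\<bar>real_of_int n * pi\<bar> < L + 1" using z by (auto simp: n S_def in_box_complex_iff sampling_node_def)
      then have "\<bar>real_of_int n * pi\<bar> < (real P + 1) * pi" using pi_gt3 by (simp add: Lpi algebra_simps)
      then have "\<bar>real_of_int n\<bar> < real P + 1" by (simp add: abs_mult)
      then have "n \<in> {- int P..int P}" by auto
      then have "z \<in> pts" by (auto simp: n pts_def interp_nodes_def)
      with z show False by simp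
    qed
    then show "z * (z - of_real s) * sin (z + of_real \<epsilon>) \<noteq> 0" using z zero_pts by auto
  qed
  have im_S: "path_image (rectpath a b) \<subseteq> S - pts"
    using path_image_rectpath_cbox_minus_box[OF le_ab] cbox_S pts_box by blast
  have "contour_integral (rectpath a b) ?F =
      2 * pi * \<i> * (\<Sum>p\<in>pts. winding_number (rectpath a b) p * residue ?F p)"
  proof (rule Residue_theorem[OF _ _ fin holo _ _ im_S])
    show "open S" "connected S" by (auto simp: S_def intro: convex_connected)
    show "\<forall>z. z \<notin> S \<longrightarrow> winding_number (rectpath a b) z = 0"
      using cbox_S le_ab by (auto intro!: winding_number_rectpath_outside)
  qed auto
  also have "(\<Sum>p\<in>pts. winding_number (rectpath a b) p * residue ?F p) = (\<Sum>p\<in>pts. residue ?F p)"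
    using pts_box winding_number_rectpath by (intro sum.cong) auto
  also have "\<dots> = (\<Sum>\<tau>\<in>?N. residue ?F (of_real \<tau>))"
    unfolding pts_def by (subst sum.reindex) (auto simp: inj_on_def)
  finally have int: "contour_integral (rectpath a b) ?F = 2 * pi * \<i> * (\<Sum>\<tau>\<in>?N. residue ?F (of_real \<tau>))" .
  have res: "of_real (interp_weight \<epsilon> s \<tau>) * G (of_real \<tau>) = - of_real s * residue ?F (of_real \<tau>)"
    if "\<tau> \<in> ?N" for \<tau>
  proof -
    let ?U = "S - (pts - {of_real \<tau>})"
    have U: "open ?U" using fin by (intro open_Diff finite_imp_closed) (auto simp: S_def)
    have "complex_of_real \<tau> \<in> pts" using that by (auto simp: pts_def)
    then have \<tau>: "complex_of_real \<tau> \<in> ?U" and eq: "?U - {complex_of_real \<tau>} = S - pts"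
      using pts_box cbox_S box_subset_cbox[of a b] by blast+
    have "?F holomorphic_on ?U - {complex_of_real \<tau>}" unfolding eq by (rule holo)
    from interp_kernel_residue[OF es G U \<tau> that this] show ?thesis by (rule sym)
  qed
  have "(\<Sum>\<tau>\<in>?N. of_real (interp_weight \<epsilon> s \<tau>) * G (of_real \<tau>)) = - of_real s * (\<Sum>\<tau>\<in>?N. residue ?F (of_real \<tau>))"
    by (simp add: res sum_distrib_left)
  also have "norm \<dots> = s / (2 * pi) * norm (contour_integral (rectpath a b) ?F)"
    using es by (simp add: int norm_mult)
  finally have sum_eq: "norm (\<Sum>\<tau>\<in>?N. of_real (interp_weight \<epsilon> s \<tau>) * G (of_real \<tau>))
      = s / (2 * pi) * norm (contour_integral (rectpath a b) ?F)" .
  have "norm (contour_integral (rectpath a b) ?F) \<le>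
      16 * C / (real P * pi)\<^sup>2 * (2 * \<bar>Re b - Re a\<bar> + 2 * \<bar>Im b - Im a\<bar>)"
  proof (rule norm_contour_integral_rectpath_le)
    show "continuous_on (path_image (rectpath a b)) ?F"
      using holo im_S holomorphic_on_imp_continuous_on holomorphic_on_subset by blast
    show "0 \<le> 16 * C / (real P * pi)\<^sup>2" using \<open>C \<ge> 0\<close> by simp
    fix z assume "z \<in> path_image (rectpath a b)"
    then have edge: "\<bar>Re z + \<epsilon>\<bar> = L \<or> \<bar>Im z\<bar> = L"
      unfolding path_image_rectpath[OF le_ab] by (auto simp: a_def b_def)
    have far: "norm z \<ge> real P * pi / 2 \<and> norm (z - of_real s) \<ge> real P * pi / 2"
    proof -
      have "\<bar>Re z\<bar> \<le> norm z" "\<bar>Im z\<bar> \<le> norm z" "\<bar>Re z - s\<bar> \<le> norm (z - of_real s)" "\<bar>Im z\<bar> \<le> norm (z - of_real s)"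
        using abs_Re_le_cmod[of z] abs_Im_le_cmod[of z] abs_Re_le_cmod[of "z - of_real s"] abs_Im_le_cmod[of "z - of_real s"]
        by simp_all
      then show ?thesis using edge es pi1 pi_gt_zero unfolding Lpi by argo
    qed
    have "1 \<le> norm z" using far pi1 pi_gt3 by linarith
    have "exp \<bar>Im (z + of_real \<epsilon>)\<bar> / 4 \<le> norm (sin (z + of_real \<epsilon>))"
    proof (rule norm_sin_ge_exp_Im)
      have "cos (2 * L) = cos (real (2 * P + 1) * pi)" by (simp add: L_def algebra_simps)
      also have "\<dots> = - 1" by (simp only: cos_npi) simp
      finally have "cos (2 * L) = - 1" .
      moreover have "cos (2 * (Re z + \<epsilon>)) = cos (2 * L)" if "\<bar>Re z + \<epsilon>\<bar> = L"
      proof -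
        have "Re z + \<epsilon> = L \<or> Re z + \<epsilon> = - L" using that by linarith
        then show ?thesis by (metis cos_minus mult_minus_right)
      qed
      moreover have "\<bar>Im z\<bar> \<ge> 1" if "\<bar>Im z\<bar> = L" using that L pi_gt3 by linarith
      ultimately show "cos (2 * Re (z + of_real \<epsilon>)) = - 1 \<or> \<bar>Im (z + of_real \<epsilon>)\<bar> \<ge> 1"
        using edge by auto
    qed
    then have sin: "exp \<bar>Im z\<bar> / 4 \<le> norm (sin (z + of_real \<epsilon>))" by simp
    have "norm (?F z) = norm (G z) / (norm z * norm (z - of_real s) * norm (sin (z + of_real \<epsilon>)))"
      by (simp add: norm_divide norm_mult)
    also have "\<dots> \<le> C * exp \<bar>Im z\<bar> / ((real P * pi / 2) * (real P * pi / 2) * (exp \<bar>Im z\<bar> / 4))"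
      using far sin growth[OF \<open>1 \<le> norm z\<close>] \<open>P \<ge> 1\<close> \<open>C \<ge> 0\<close>
      by (intro frac_le mult_mono mult_pos_pos) auto
    also have "\<dots> = 16 * C / (real P * pi)\<^sup>2" by (simp add: power2_eq_square mult_ac)
    finally show "norm (?F z) \<le> 16 * C / (real P * pi)\<^sup>2" .
  qed
  also have "2 * \<bar>Re b - Re a\<bar> + 2 * \<bar>Im b - Im a\<bar> = 8 * L"
    using L by (simp add: a_def b_def)
  finally have "s / (2 * pi) * norm (contour_integral (rectpath a b) ?F) \<le>
     s / (2 * pi) * (16 * C / (real P * pi)\<^sup>2 * (8 * L))"
    using es by (intro mult_left_mono) auto
  also have "\<dots> \<le> s / (2 * pi) * (16 * C / (real P * pi)\<^sup>2 * (8 * (3 / 2 * (real P * pi))))"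
    using es pi1 \<open>C \<ge> 0\<close> unfolding Lpi by (intro mult_left_mono) auto
  also have "\<dots> = 96 * s * C / real P * (1 / pi\<^sup>2)"
    using \<open>P \<ge> 1\<close> by (simp add: power2_eq_square field_simps)
  also have "\<dots> \<le> 96 * s * C / real P * 1"
    using es \<open>C \<ge> 0\<close> pi_gt3 by (intro mult_left_mono) (auto simp: one_le_power)
  finally show ?thesis unfolding sum_eq by simp
qed

text \<open>
The function $\cos(z+\epsilon)$ is extremal: at the zeros of $\sin(z+\epsilon)$ it takes the values
$\pm 1$ with signs opposite to the weights. Interpolating it therefore evaluates the sum of the
absolute values of the weights, with equality in the limit.
\<close>
lemma sum_abs_interp_weight:
  assumes es: "0 < \<epsilon>" "0 < s" "s + \<epsilon> < pi" and "P \<ge> 1"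
  shows "(\<Sum>n\<in>{- int P..int P}. \<bar>interp_weight \<epsilon> s (sampling_node \<epsilon> n)\<bar>)
    \<le> cos \<epsilon> / sin \<epsilon> - cos (s + \<epsilon>) / sin (s + \<epsilon>) + 96 * s / real P"
proof -
  let ?w = "interp_weight \<epsilon> s"
  let ?A = "\<Sum>n\<in>{- int P..int P}. \<bar>?w (sampling_node \<epsilon> n)\<bar>"
  have sgn: "?w (sampling_node \<epsilon> n) * cos (sampling_node \<epsilon> n + \<epsilon>) = - \<bar>?w (sampling_node \<epsilon> n)\<bar>" for n
  proof -
    define \<tau> where "\<tau> = sampling_node \<epsilon> n"
    have \<tau>: "\<tau> < 0 \<or> \<tau> > s" using sampling_node_not_between[of \<epsilon> s n] es by (simp add: \<tau>_def)
    define p where "p = \<tau> * (\<tau> - s)"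
    have pos: "p > 0" using \<tau> es by (auto simp: p_def zero_less_mult_iff)
    have "?w \<tau> = - s * cos (\<tau> + \<epsilon>) / p"
      unfolding p_def interp_weight_def using \<tau> es by (intro if_not_P[THEN trans] if_not_P) auto
    moreover have "cos (\<tau> + \<epsilon>) = 1 \<or> cos (\<tau> + \<epsilon>) = - 1"
      using cos_int_pi_sampling[of \<epsilon> n] by (auto simp: \<tau>_def)
    ultimately show ?thesis using pos es by (auto simp: \<tau>_def[symmetric] abs_mult)
  qed
  have "norm (\<Sum>\<tau>\<in>interp_nodes \<epsilon> s P. of_real (?w \<tau>) * cos (complex_of_real \<tau> + of_real \<epsilon>)) \<le> 96 * s * 1 / real P"
  proof (rule interpolation_error[OF es])
    show "(\<lambda>z. cos (z + complex_of_real \<epsilon>)) holomorphic_on UNIV" by (intro holomorphic_intros)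
    show "norm (cos (z + complex_of_real \<epsilon>)) \<le> 1 * exp \<bar>Im z\<bar>" for z
      using norm_cos_le_exp_Im[of "z + complex_of_real \<epsilon>"] by simp
  qed (use \<open>P \<ge> 1\<close> in auto)
  also have "(\<Sum>\<tau>\<in>interp_nodes \<epsilon> s P. of_real (?w \<tau>) * cos (complex_of_real \<tau> + of_real \<epsilon>))
     = of_real (\<Sum>\<tau>\<in>interp_nodes \<epsilon> s P. ?w \<tau> * cos (\<tau> + \<epsilon>))"
    by (simp add: cos_of_real flip: of_real_add)
  also have "norm \<dots> = \<bar>\<Sum>\<tau>\<in>interp_nodes \<epsilon> s P. ?w \<tau> * cos (\<tau> + \<epsilon>)\<bar>" by (rule norm_of_real)
  also have "(\<Sum>\<tau>\<in>interp_nodes \<epsilon> s P. ?w \<tau> * cos (\<tau> + \<epsilon>)) = cos \<epsilon> / sin \<epsilon> - cos (s + \<epsilon>) / sin (s + \<epsilon>) - ?A"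
    using es by (subst sum_interp_nodes) (auto simp: sgn sum_negf interp_weight_def[of _ _ 0] interp_weight_def[of _ s s])
  finally show ?thesis by (simp add: abs_le_iff)
qed

definition csinc :: "complex \<Rightarrow> complex" where
  "csinc z = (if z = 0 then 1 else sin z / z)"

lemma csinc_holomorphic: "csinc holomorphic_on UNIV"
proof -
  have "deriv sin (0::complex) = 1"
    by (rule DERIV_imp_deriv) (auto intro!: derivative_eq_intros)
  moreover have "(\<lambda>z. if z = 0 then deriv sin 0 else (sin z - sin 0) / (z - 0)) holomorphic_on (UNIV :: complex set)"
    by (intro pole_lemma_open holomorphic_intros) auto
  ultimately have "(\<lambda>z::complex. if z = 0 then 1 else (sin z - sin 0) / (z - 0)) holomorphic_on UNIV"
    by (simp only:)
  then show ?thesis unfolding csinc_def[abs_def] by (simp only: sin_zero diff_zero)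
qed

lemma norm_csinc_le: "norm (csinc z) \<le> exp \<bar>Im z\<bar> / norm z" if "z \<noteq> 0"
  using that norm_sin_le_exp_Im[of z] by (auto simp: csinc_def norm_divide divide_right_mono)

lemma csinc_of_real_abs_le: "norm (csinc (of_real x)) \<le> 1"
  using abs_sin_x_le_abs_x[of x] by (auto simp: csinc_def norm_divide sin_of_real simp flip: of_real_divide)

text \<open>
Multiplying $e^{-iz\xi}$ by $(\sin(\delta z)/(\delta z))^N$ costs $N\delta$ of exponential type and
gains \<open>N\<close> powers of decay, which pay for the factor $(-iz)^k$. That factor is what
differentiating \<open>k\<close> times in \<open>\<xi>\<close> produces, so the trigonometric sum in
\<open>\<xi>\<close> with these weights tends to zero on the given interval uniformly and together
with its derivatives up to order \<open>N\<close>.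
\<close>
lemma decaying_exponential_interpolation_error:
  assumes es: "0 < \<epsilon>" "0 < s" "s + \<epsilon> < pi" and \<delta>: "0 < \<delta>" and \<xi>: "\<bar>\<xi>\<bar> + real N * \<delta> \<le> 1"
    and "k \<le> N" "P \<ge> 1"
  shows "norm (\<Sum>\<tau>\<in>interp_nodes \<epsilon> s P. of_real (interp_weight \<epsilon> s \<tau>) * csinc (of_real (\<delta> * \<tau>)) ^ N *
      (- \<i> * of_real \<tau>) ^ k * exp (- \<i> * of_real (\<tau> * \<xi>))) \<le> 96 * s * (1 / \<delta> ^ N) / real P"
proof -
  let ?G = "\<lambda>z. csinc (of_real \<delta> * z) ^ N * (- \<i> * z) ^ k * exp (- \<i> * z * of_real \<xi>)"
  have "norm (\<Sum>\<tau>\<in>interp_nodes \<epsilon> s P. of_real (interp_weight \<epsilon> s \<tau>) * ?G (of_real \<tau>)) \<le> 96 * s * (1 / \<delta> ^ N) / real P"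
  proof (rule interpolation_error[OF es])
    have "(csinc \<circ> (\<lambda>z. of_real \<delta> * z)) holomorphic_on UNIV"
      by (rule holomorphic_on_compose) (auto intro!: holomorphic_intros holomorphic_on_subset[OF csinc_holomorphic])
    then have "(\<lambda>z. csinc (of_real \<delta> * z)) holomorphic_on UNIV" by (simp add: o_def)
    then show "?G holomorphic_on UNIV" by (intro holomorphic_intros)
    show "0 \<le> 1 / \<delta> ^ N" using \<delta> by simp
    fix z :: complex assume z: "1 \<le> norm z"
    then have "z \<noteq> 0" by auto
    have "norm (csinc (of_real \<delta> * z)) \<le> exp (\<delta> * \<bar>Im z\<bar>) / (\<delta> * norm z)"
      using norm_csinc_le[of "of_real \<delta> * z"] \<open>z \<noteq> 0\<close> \<delta> by (simp add: norm_mult abs_mult)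
    then have "norm (csinc (of_real \<delta> * z)) ^ N \<le> (exp (\<delta> * \<bar>Im z\<bar>) / (\<delta> * norm z)) ^ N"
      by (intro power_mono) auto
    also have "\<dots> = exp (real N * \<delta> * \<bar>Im z\<bar>) / (\<delta> ^ N * norm z ^ N)"
      by (simp add: power_divide power_mult_distrib mult.assoc flip: exp_of_nat_mult)
    finally have 1: "norm (csinc (of_real \<delta> * z)) ^ N \<le> exp (real N * \<delta> * \<bar>Im z\<bar>) / (\<delta> ^ N * norm z ^ N)" .
    have 2: "norm z ^ k \<le> norm z ^ N" using z \<open>k \<le> N\<close> by (intro power_increasing) auto
    have "Im z * \<xi> \<le> \<bar>\<xi>\<bar> * \<bar>Im z\<bar>" by (metis abs_ge_self abs_mult mult.commute)
    then have 3: "norm (exp (- \<i> * z * of_real \<xi>)) \<le> exp (\<bar>\<xi>\<bar> * \<bar>Im z\<bar>)"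
      by (simp add: norm_exp_eq_Re)
    have "norm (?G z) \<le> exp (real N * \<delta> * \<bar>Im z\<bar>) / (\<delta> ^ N * norm z ^ N) * norm z ^ N * exp (\<bar>\<xi>\<bar> * \<bar>Im z\<bar>)"
      unfolding norm_mult norm_power using 1 2 3 \<delta> by (intro mult_mono) auto
    also have "\<dots> = 1 / \<delta> ^ N * exp ((\<bar>\<xi>\<bar> + real N * \<delta>) * \<bar>Im z\<bar>)"
      using \<open>z \<noteq> 0\<close> by (simp add: distrib_right exp_add)
    also have "\<dots> \<le> 1 / \<delta> ^ N * exp (1 * \<bar>Im z\<bar>)"
      using mult_right_mono[OF \<xi> abs_ge_zero[of "Im z"]] \<delta> by (intro mult_left_mono) auto
    finally show "norm (?G z) \<le> 1 / \<delta> ^ N * exp \<bar>Im z\<bar>" by simp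
  qed (use \<open>P \<ge> 1\<close> in auto)
  then show ?thesis by (simp add: mult_ac)
qed

text \<open>
Solve the interpolation relation for its value at $0$ and estimate the values at the zeros of
$\sin(z+\epsilon)$ by \<open>M\<close>; the sum of the absolute weights is at most
$\cot\epsilon-\cot(s+\epsilon)$ up to $O(1/P)$. The decay factor has absolute value at most $1$ on
the real line and does not spoil this.
\<close>
lemma approximate_interpolation_inequality:
  fixes A :: "real \<Rightarrow> complex"
  assumes es: "0 < \<epsilon>" "0 < s" "s + \<epsilon> < pi" and M: "\<And>\<tau>. norm (A \<tau>) \<le> M"
    and conv: "\<And>P. P \<ge> 1 \<Longrightarrow> norm (\<Sum>\<tau>\<in>interp_nodes \<epsilon> s P.
      of_real (interp_weight \<epsilon> s \<tau>) * csinc (of_real (\<delta> * \<tau>)) ^ N * A \<tau>) \<le> D / real P"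
  shows "norm (A 0) / sin \<epsilon> \<le> norm (A s) / sin (s + \<epsilon>) + M * (cos \<epsilon> / sin \<epsilon> - cos (s + \<epsilon>) / sin (s + \<epsilon>))"
proof -
  let ?w = "interp_weight \<epsilon> s"
  let ?j = "\<lambda>\<tau>. csinc (of_real (\<delta> * \<tau>)) ^ N"
  let ?R = "norm (A s) / sin (s + \<epsilon>) + M * (cos \<epsilon> / sin \<epsilon> - cos (s + \<epsilon>) / sin (s + \<epsilon>))"
  have sn: "sin \<epsilon> > 0" "sin (s + \<epsilon>) > 0" using es by (auto intro!: sin_gt_zero)
  have j: "norm (?j \<tau>) \<le> 1" for \<tau>
    unfolding norm_power using csinc_of_real_abs_le[of "\<delta> * \<tau>"] by (intro power_le_one) auto
  have "M \<ge> 0" using M[of 0] norm_ge_zero order_trans by blast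
  have bound: "norm (A 0) / sin \<epsilon> \<le> ?R + (M * 96 * s + D) * (1 / real P)" if "P \<ge> 1" for P
  proof -
    define \<Sigma> where "\<Sigma> = (\<Sum>n\<in>{- int P..int P}. of_real (?w (sampling_node \<epsilon> n)) * ?j (sampling_node \<epsilon> n) * A (sampling_node \<epsilon> n))"
    define E where "E = (\<Sum>\<tau>\<in>interp_nodes \<epsilon> s P. of_real (?w \<tau>) * ?j \<tau> * A \<tau>)"
    have "E = of_real (?w 0) * ?j 0 * A 0 + of_real (?w s) * ?j s * A s + \<Sigma>"
      unfolding E_def \<Sigma>_def by (rule sum_interp_nodes[OF es])
    then have eq: "of_real (1 / sin \<epsilon>) * A 0 = E + (of_real (1 / sin (s + \<epsilon>)) * (?j s * A s) + - \<Sigma>)"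
      using es by (simp add: interp_weight_def csinc_def)
    have "norm \<Sigma> \<le> (\<Sum>n\<in>{- int P..int P}. \<bar>?w (sampling_node \<epsilon> n)\<bar> * M)"
      unfolding \<Sigma>_def
    proof (rule sum_norm_le)
      fix n
      have "norm (?j (sampling_node \<epsilon> n)) * norm (A (sampling_node \<epsilon> n)) \<le> 1 * M"
        using j M \<open>M \<ge> 0\<close> by (intro mult_mono) auto
      then show "norm (of_real (?w (sampling_node \<epsilon> n)) * ?j (sampling_node \<epsilon> n) * A (sampling_node \<epsilon> n)) \<le> \<bar>?w (sampling_node \<epsilon> n)\<bar> * M"
        unfolding norm_mult norm_of_real mult.assoc by (intro mult_left_mono) auto
    qed
    also have "\<dots> = (\<Sum>n\<in>{- int P..int P}. \<bar>?w (sampling_node \<epsilon> n)\<bar>) * M" by (simp add: sum_distrib_right)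
    also have "\<dots> \<le> (cos \<epsilon> / sin \<epsilon> - cos (s + \<epsilon>) / sin (s + \<epsilon>) + 96 * s / real P) * M"
      using sum_abs_interp_weight[OF es that] \<open>M \<ge> 0\<close> by (rule mult_right_mono)
    finally have \<Sigma>: "norm \<Sigma> \<le> (cos \<epsilon> / sin \<epsilon> - cos (s + \<epsilon>) / sin (s + \<epsilon>) + 96 * s / real P) * M" .
    have As: "norm (of_real (1 / sin (s + \<epsilon>)) * (?j s * A s)) \<le> norm (A s) / sin (s + \<epsilon>)"
    proof -
      have "norm (?j s * A s) \<le> norm (A s)" using j[of s] by (simp add: norm_mult mult_left_le_one_le)
      then show ?thesis using sn unfolding norm_mult norm_of_real by (simp add: divide_right_mono)
    qed
    have "norm (A 0) / sin \<epsilon> = norm (of_real (1 / sin \<epsilon>) * A 0)"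
      using sn unfolding norm_mult norm_of_real by simp
    also have "\<dots> \<le> norm E + (norm (of_real (1 / sin (s + \<epsilon>)) * (?j s * A s)) + norm \<Sigma>)"
      unfolding eq by (intro norm_triangle_mono) auto
    also have "\<dots> \<le> D / real P + (norm (A s) / sin (s + \<epsilon>) +
        (cos \<epsilon> / sin \<epsilon> - cos (s + \<epsilon>) / sin (s + \<epsilon>) + 96 * s / real P) * M)"
      using conv[OF that] As \<Sigma> unfolding E_def by linarith
    also have "\<dots> = ?R + (M * 96 * s + D) * (1 / real P)" by (simp add: algebra_simps add_divide_distrib)
    finally show ?thesis .
  qed
  have "(\<lambda>P. ?R + (M * 96 * s + D) * (1 / real P)) \<longlonglongrightarrow> ?R + (M * 96 * s + D) * 0"
    by (intro tendsto_intros lim_1_over_n)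
  moreover have "\<forall>\<^sub>F P in sequentially. norm (A 0) / sin \<epsilon> \<le> ?R + (M * 96 * s + D) * (1 / real P)"
    using eventually_ge_at_top[of 1] by eventually_elim (rule bound)
  ultimately have "norm (A 0) / sin \<epsilon> \<le> ?R + (M * 96 * s + D) * 0"
    by (rule tendsto_lowerbound) simp
  then show ?thesis by simp
qed

section \<open>Trigonometric sums against a distribution of compact support\<close>

lemma trigonometric_sum_partial_derivs:
  fixes u :: "real^'n::finite" and c :: "real \<Rightarrow> complex"
  assumes "finite A"
  defines "W k x \<equiv> \<Sum>\<tau>\<in>A. c \<tau> * (- \<i> * of_real \<tau>) ^ k * exp (- \<i> * of_real (\<tau> * (u \<bullet> x)))"
  shows "partial_derivs \<beta> (W 0) = (\<lambda>x. of_real (\<Prod>i\<leftarrow>\<beta>. u $ i) * W (length \<beta>) x)"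
    and "bounded_derivs (W 0)"
proof -
  have e: "((\<lambda>x. exp (- \<i> * of_real (\<tau> * (u \<bullet> x)))) has_derivative
      (\<lambda>h. exp (- \<i> * of_real (\<tau> * (u \<bullet> x))) * (- \<i> * of_real (\<tau> * (u \<bullet> h))))) (at x)" for \<tau> x
  proof -
    have "((\<lambda>x. - \<i> * of_real (\<tau> * (u \<bullet> x))) has_derivative (\<lambda>h. - \<i> * of_real (\<tau> * (u \<bullet> h)))) (at x)"
      by (intro has_derivative_mult_right has_derivative_of_real has_derivative_inner_right has_derivative_ident)
    from has_derivative_compose[OF this DERIV_exp[unfolded has_field_derivative_def]] show ?thesis .
  qed
  have d: "(W k has_derivative (\<lambda>h. of_real (u \<bullet> h) * W (Suc k) x)) (at x)" for k x
    unfolding W_def sum_distrib_left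
    by (rule has_derivative_sum, rule has_derivative_eq_rhs[OF has_derivative_mult_right[OF e]])
      (simp add: algebra_simps)
  have pd: "partial_deriv i (W k) = (\<lambda>x. of_real (u $ i) * W (Suc k) x)" for i k
    using partial_derivI[OF d] by (auto simp: inner_axis)
  show eq: "partial_derivs \<beta> (W 0) = (\<lambda>x. of_real (\<Prod>i\<leftarrow>\<beta>. u $ i) * W (length \<beta>) x)" for \<beta>
  proof (induction \<beta>)
    case (Cons i \<beta>)
    have "W (length \<beta>) differentiable (at x)" for x using d unfolding differentiable_def by blast
    then have "partial_deriv i (\<lambda>x. of_real (\<Prod>i\<leftarrow>\<beta>. u $ i) * W (length \<beta>) x) x
       = of_real (\<Prod>i\<leftarrow>\<beta>. u $ i) * partial_deriv i (W (length \<beta>)) x" for x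
      by (subst partial_deriv_mult) auto
    then show ?case by (auto simp: Cons pd)
  qed simp
  have W_le: "cmod (W k x) \<le> (\<Sum>\<tau>\<in>A. cmod (c \<tau>) * \<bar>\<tau>\<bar> ^ k)" for k x
    unfolding W_def by (rule sum_norm_le) (simp add: norm_mult norm_power norm_exp_eq_Re)
  show "bounded_derivs (W 0)"
    unfolding bounded_derivs_def smooth_fun_def
  proof (intro conjI allI)
    fix \<beta> x
    have "(\<lambda>x. of_real (\<Prod>i\<leftarrow>\<beta>. u $ i) * W (length \<beta>) x) differentiable (at x)"
      using d by (intro differentiable_mult differentiable_const) (auto simp: differentiable_def)
    then show "partial_derivs \<beta> (W 0) differentiable (at x)" by (simp add: eq)
    have "cmod (partial_derivs \<beta> (W 0) x) \<le> \<bar>\<Prod>i\<leftarrow>\<beta>. u $ i\<bar> * (\<Sum>\<tau>\<in>A. cmod (c \<tau>) * \<bar>\<tau>\<bar> ^ length \<beta>)" for x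
      unfolding eq norm_mult norm_of_real by (intro mult_left_mono W_le) auto
    then show "\<exists>C. \<forall>x. cmod (partial_derivs \<beta> (W 0) x) \<le> C" by blast
  qed
qed

text \<open>
If \<open>K\<close> lies in the strip $|u\cdot x|\le r$, then \<open>T\<close> only sees a
trigonometric polynomial in $u\cdot x$ through its derivatives on a slightly wider strip. The
strip is unbounded, so the cutoff is taken as a function of $(u\cdot x)^2+\delta|x|^2$, whose sublevel
sets are compact; for small \<open>\<delta>\<close> one of them contains \<open>K\<close> in its
interior and still lies in the wider strip.
\<close>
lemma distribution_trigonometric_bound:
  fixes T :: "(real^'n::finite \<Rightarrow> complex) \<Rightarrow> complex"
  assumes T: "tempered_distribution T" and supp: "supported_by T K" and N: "distribution_order T N"
    and K: "compact K" "\<And>x. x \<in> K \<Longrightarrow> \<bar>u \<bullet> x\<bar> \<le> r" and r: "0 \<le> r" "r < r'"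
    and \<Phi>: "\<Phi> \<in> schwartz_space"
  shows "\<exists>B. \<forall>A c \<eta>. finite A \<longrightarrow> 0 \<le> \<eta> \<longrightarrow>
    (\<forall>k \<xi>. k \<le> N \<longrightarrow> \<bar>\<xi>\<bar> \<le> r' \<longrightarrow>
      cmod (\<Sum>\<tau>\<in>A. c \<tau> * (- \<i> * of_real \<tau>) ^ k * exp (- \<i> * of_real (\<tau> * \<xi>))) \<le> \<eta>) \<longrightarrow>
    cmod (T (\<lambda>x. (\<Sum>\<tau>\<in>A. c \<tau> * exp (- \<i> * of_real (\<tau> * (u \<bullet> x)))) * \<Phi> x)) \<le> B * \<eta>"
proof -
  obtain R where R: "\<And>x. x \<in> K \<Longrightarrow> norm x \<le> R" using K(1) compact_imp_bounded bounded_iff by metis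
  define \<delta> where "\<delta> = (r'\<^sup>2 - r\<^sup>2) / (2 * (R\<^sup>2 + 1))"
  define q where "q = (\<lambda>x. (u \<bullet> x)\<^sup>2 + \<delta> * (norm x)\<^sup>2)"
  define a where "a = (r'\<^sup>2 + r\<^sup>2) / 2"
  have rr: "r\<^sup>2 < r'\<^sup>2" using r by (intro power_strict_mono) auto
  have R1: "R\<^sup>2 + 1 > 0" by (simp add: add_nonneg_pos)
  have \<delta>: "\<delta> > 0" using rr R1 by (simp add: \<delta>_def)
  have \<delta>R: "\<delta> * R\<^sup>2 < (r'\<^sup>2 - r\<^sup>2) / 2" using rr R1 by (simp add: \<delta>_def field_simps)
  have "(\<lambda>x. complex_of_real (u \<bullet> x) * of_real (u \<bullet> x) + of_real \<delta> * of_real ((norm x)\<^sup>2)) \<in> polynomial_funs"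
    by (intro polynomial_funs_add polynomial_funs_mult polynomial_funs_inner polynomial_funs_const polynomial_funs_norm_square)
  also have "(\<lambda>x. complex_of_real (u \<bullet> x) * of_real (u \<bullet> x) + of_real \<delta> * of_real ((norm x)\<^sup>2)) = (\<lambda>x. of_real (q x))"
    by (simp add: q_def power2_eq_square)
  finally have q_sm: "smooth_fun (\<lambda>x. complex_of_real (q x))"
    by (rule polynomial_funs_smooth)
  have ab: "a < r'\<^sup>2" using rr by (simp add: a_def)
  obtain \<psi> where \<psi>: "smooth_fun \<psi>" "\<And>x. q x \<le> a \<Longrightarrow> \<psi> x = 1" "\<And>x. r'\<^sup>2 \<le> q x \<Longrightarrow> \<psi> x = 0"
    using smooth_cutoff[OF q_sm ab] by metis
  have qn: "\<delta> * (norm x)\<^sup>2 \<le> q x" for x by (simp add: q_def)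
  have bd\<psi>: "bounded_derivs \<psi>"
  proof (rule smooth_compact_support_bounded_derivs[OF \<psi>(1)])
    fix x :: "real^'n" assume x: "norm x > sqrt (r'\<^sup>2 / \<delta>)"
    then have "r'\<^sup>2 / \<delta> \<le> (norm x)\<^sup>2"
      by (meson less_imp_le norm_ge_zero order_trans real_sqrt_ge_zero sqrt_le_D)
    then have "r'\<^sup>2 \<le> q x" using \<delta> qn[of x] by (simp add: field_simps)
    then show "\<psi> x = 0" by (rule \<psi>(3))
  qed
  define \<theta> where "\<theta> = (\<lambda>x. \<psi> x * \<Phi> x)"
  define \<kappa> where "\<kappa> = (\<lambda>x. (1 - \<psi> x) * \<Phi> x)"
  define S where "S = {x. q x \<le> r'\<^sup>2}"
  have q_cont: "continuous_on UNIV q" unfolding q_def by (intro continuous_intros)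
  have \<theta>: "\<theta> \<in> schwartz_space" unfolding \<theta>_def using bd\<psi> \<Phi> by (rule schwartz_space_mult)
  have \<kappa>: "\<kappa> \<in> schwartz_space" unfolding \<kappa>_def
    using bounded_derivs_one_minus[OF bd\<psi>] \<Phi> by (rule schwartz_space_mult)
  have S: "closed S" unfolding S_def using q_cont by (intro closed_Collect_le) auto
  have off: "\<forall>x. x \<notin> S \<longrightarrow> \<theta> x = 0" using \<psi>(3) by (auto simp: S_def \<theta>_def)
  obtain B where B: "multiplier_bound T N \<theta> S B"
    using N \<theta> S off unfolding distribution_order_def by blast
  have S_strip: "\<bar>u \<bullet> x\<bar> \<le> r'" if "x \<in> S" for x
  proof -
    have "(u \<bullet> x)\<^sup>2 \<le> r'\<^sup>2" using that \<delta> by (simp add: S_def q_def) (smt (verit) mult_nonneg_nonneg zero_le_power2)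
    then show ?thesis using r by (metis abs_le_square_iff abs_of_nonneg less_imp_le order_trans)
  qed
  define m where "m = max 1 (norm u) ^ N"
  have m: "m \<ge> 0" by (simp add: m_def)
  show ?thesis
  proof (intro exI[of _ "B * m"] allI impI)
    fix A and c :: "real \<Rightarrow> complex" and \<eta> :: real
    assume A: "finite A" and \<eta>: "0 \<le> \<eta>"
      and small: "\<forall>k \<xi>. k \<le> N \<longrightarrow> \<bar>\<xi>\<bar> \<le> r' \<longrightarrow>
        cmod (\<Sum>\<tau>\<in>A. c \<tau> * (- \<i> * of_real \<tau>) ^ k * exp (- \<i> * of_real (\<tau> * \<xi>))) \<le> \<eta>"
    define g where "g = (\<lambda>x. \<Sum>\<tau>\<in>A. c \<tau> * exp (- \<i> * of_real (\<tau> * (u \<bullet> x))))"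
    have bdg: "bounded_derivs g"
      using trigonometric_sum_partial_derivs(2)[OF A, of c u] by (simp add: g_def)
    have dg: "partial_derivs \<beta> g x = of_real (\<Prod>i\<leftarrow>\<beta>. u $ i) *
      (\<Sum>\<tau>\<in>A. c \<tau> * (- \<i> * of_real \<tau>) ^ length \<beta> * exp (- \<i> * of_real (\<tau> * (u \<bullet> x))))" for \<beta> x
      using fun_cong[OF trigonometric_sum_partial_derivs(1)[OF A, of \<beta> c u], of x] by (simp add: g_def)
    have ul: "\<bar>\<Prod>i\<leftarrow>\<beta>. u $ i\<bar> \<le> max 1 (norm u) ^ length \<beta>" for \<beta>
    proof (induction \<beta>)
      case (Cons i \<beta>)
      have "\<bar>u $ i\<bar> \<le> max 1 (norm u)" using component_le_norm_cart[of u i] by simp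
      then show ?case using Cons by (simp add: abs_mult mult_mono)
    qed simp
    have 1: "cmod (T (\<lambda>x. g x * \<theta> x)) \<le> B * (m * \<eta>)"
    proof (rule multiplier_boundD[OF B bdg])
      show "0 \<le> m * \<eta>" using m \<eta> by simp
      fix \<gamma> :: "'n list" and x assume x: "x \<in> S" and \<gamma>: "length \<gamma> \<le> N"
      have "\<bar>\<Prod>i\<leftarrow>\<gamma>. u $ i\<bar> \<le> m"
        using ul[of \<gamma>] power_increasing[OF \<gamma>, of "max 1 (norm u)"] unfolding m_def by linarith
      then have "cmod (partial_derivs \<gamma> g x) \<le> m * \<eta>"
        unfolding dg norm_mult norm_of_real using small[rule_format, OF \<gamma> S_strip[OF x]] m by (intro mult_mono) auto
      also have "\<dots> \<le> m * \<eta> * (1 + norm x)" using m \<eta> by (simp add: distrib_left)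
      finally show "cmod (partial_derivs \<gamma> g x) \<le> m * \<eta> * (1 + norm x)" .
    qed
    have "T (\<lambda>x. g x * \<kappa> x) = 0"
    proof (rule distribution_vanish_off_support[OF T supp])
      show "open {x. q x < a}" using q_cont by (intro open_Collect_less) auto
      show "K \<subseteq> {x. q x < a}"
      proof
        fix x assume x: "x \<in> K"
        have "(u \<bullet> x)\<^sup>2 \<le> r\<^sup>2" using K(2)[OF x] r(1) by (simp add: abs_le_square_iff[symmetric])
        moreover have "(norm x)\<^sup>2 \<le> R\<^sup>2" using R[OF x] by (intro power_mono) auto
        then have "\<delta> * (norm x)\<^sup>2 \<le> \<delta> * R\<^sup>2" using \<delta> by (intro mult_left_mono) auto
        ultimately show "x \<in> {x. q x < a}" using \<delta>R by (simp add: q_def a_def field_simps)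
      qed
      show "(\<lambda>x. g x * \<kappa> x) \<in> schwartz_space" using bdg \<kappa> by (rule schwartz_space_mult)
      show "g x * \<kappa> x = 0" if "x \<in> {x. q x < a}" for x using that \<psi>(2)[of x] by (simp add: \<kappa>_def)
    qed
    moreover have "T (\<lambda>x. g x * \<theta> x + g x * \<kappa> x) = T (\<lambda>x. g x * \<theta> x) + T (\<lambda>x. g x * \<kappa> x)"
      using T schwartz_space_mult[OF bdg \<theta>] schwartz_space_mult[OF bdg \<kappa>] by (rule tempered_distribution_add)
    moreover have "(\<lambda>x. g x * \<theta> x + g x * \<kappa> x) = (\<lambda>x. g x * \<Phi> x)"
      by (auto simp: \<theta>_def \<kappa>_def algebra_simps)
    ultimately have "T (\<lambda>x. g x * \<Phi> x) = T (\<lambda>x. g x * \<theta> x)" by simp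
    with 1 show "cmod (T (\<lambda>x. (\<Sum>\<tau>\<in>A. c \<tau> * exp (- \<i> * of_real (\<tau> * (u \<bullet> x)))) * \<Phi> x)) \<le> B * m * \<eta>"
      by (simp add: g_def mult.assoc)
  qed
qed

section \<open>Gaussian mollification\<close>

lemma lborel_product_function:
  fixes f :: "'a::euclidean_space \<Rightarrow> real \<Rightarrow> complex"
  assumes f: "\<And>b. b \<in> Basis \<Longrightarrow> integrable lborel (f b)"
  shows "integrable lborel (\<lambda>x::'a. \<Prod>b\<in>Basis. f b (x \<bullet> b))"
    and "(LINT x|lborel. (\<Prod>b\<in>Basis. f b (x \<bullet> b))) = (\<Prod>b\<in>Basis. (LINT t|lborel. f b t))"
proof -
  interpret product_sigma_finite "\<lambda>_::'a. lborel :: real measure" by standard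
  let ?P = "\<Pi>\<^sub>M b\<in>(Basis::'a set). (lborel :: real measure)"
  let ?T = "\<lambda>g. \<Sum>b\<in>Basis. g b *\<^sub>R (b::'a)"
  have [measurable]: "f b \<in> borel_measurable borel" if "b \<in> Basis" for b
    using f[OF that] by (simp add: borel_measurable_integrable)
  have m: "(\<lambda>x::'a. \<Prod>b\<in>Basis. f b (x \<bullet> b)) \<in> borel_measurable borel"
    by measurable
  have T: "?T \<in> ?P \<rightarrow>\<^sub>M borel" by measurable
  have eq: "(\<Prod>b\<in>Basis. f b (?T g \<bullet> b)) = (\<Prod>b\<in>Basis. f b (g b))" for g
    by (intro prod.cong refl) simp
  have "integrable ?P (\<lambda>g. \<Prod>b\<in>Basis. f b (g b))"
    by (rule product_integrable_prod) (auto intro: f)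
  then show "integrable lborel (\<lambda>x::'a. \<Prod>b\<in>Basis. f b (x \<bullet> b))"
    by (subst lborel_eq, subst integrable_distr_eq[OF T m]) (simp only: eq)
  have "(LINT x|lborel. (\<Prod>b\<in>Basis. f b (x \<bullet> b))) = (LINT g|?P. (\<Prod>b\<in>Basis. f b (g b)))"
    by (subst lborel_eq, subst integral_distr[OF T m]) (simp only: eq)
  also have "\<dots> = (\<Prod>b\<in>Basis. (LINT t|lborel. f b t))"
    by (rule product_integral_prod) (auto intro: f)
  finally show "(LINT x|lborel. (\<Prod>b\<in>Basis. f b (x \<bullet> b))) = (\<Prod>b\<in>Basis. (LINT t|lborel. f b t))" .
qed

text \<open>
The substitution $t = a + \sigma y$ reduces this to the characteristic function of the standard
normal distribution.
\<close>
lemma gaussian_fourier_1d: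
  fixes a x \<sigma> :: real
  assumes "\<sigma> > 0"
  defines "h \<equiv> (\<lambda>t. exp (- \<i> * of_real (t * x)) * exp (of_real (- (t - a)\<^sup>2 / (2 * \<sigma>\<^sup>2))))"
  shows "integrable lborel h"
    and "(LINT t|lborel. h t) = of_real (sqrt (2 * pi) * \<sigma>) *
      (exp (- \<i> * of_real (a * x)) * exp (of_real (- \<sigma>\<^sup>2 * x\<^sup>2 / 2)))"
proof -
  let ?n = "\<lambda>y. std_normal_density y *\<^sub>R iexp (- \<sigma> * x * y)"
  have s2: "sqrt (2 * pi) > 0" by simp
  have h: "h (a + \<sigma> * y) = (of_real (sqrt (2 * pi)) * exp (- \<i> * of_real (a * x))) * ?n y" for y
  proof -
    have "- (a + \<sigma> * y - a)\<^sup>2 / (2 * \<sigma>\<^sup>2) = - (y\<^sup>2 / 2)"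
      using assms by (simp add: power_mult_distrib)
    moreover have "exp (- (y\<^sup>2 / 2)) = sqrt (2 * pi) * std_normal_density y"
      using s2 by (simp add: std_normal_density_def)
    ultimately have g: "exp (complex_of_real (- (a + \<sigma> * y - a)\<^sup>2 / (2 * \<sigma>\<^sup>2))) =
        of_real (sqrt (2 * pi)) * of_real (std_normal_density y)"
      by (simp only: exp_of_real of_real_mult)
    have w: "exp (- \<i> * of_real ((a + \<sigma> * y) * x)) = exp (- \<i> * of_real (a * x)) * iexp (- \<sigma> * x * y)"
      by (simp add: exp_add[symmetric] algebra_simps)
    show ?thesis unfolding h_def g w by (simp add: scaleR_conv_of_real)
  qed
  have "integrable lborel (\<lambda>y. std_normal_density y *\<^sub>R (1::real))"
    using integrable_normal_density[of 1 0] by simp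
  then have n_int: "integrable lborel ?n"
    by (rule Bochner_Integration.integrable_bound) (auto simp: norm_exp_eq_Re)
  have "(LINT y|lborel. ?n y) = char std_normal_distribution (- \<sigma> * x)"
    unfolding char_def by (subst integral_density) auto
  also have "\<dots> = exp (of_real (- \<sigma>\<^sup>2 * x\<^sup>2 / 2))"
    by (simp add: char_std_normal_distribution power_mult_distrib exp_of_real[symmetric])
  finally have n_eq: "(LINT y|lborel. ?n y) = exp (of_real (- \<sigma>\<^sup>2 * x\<^sup>2 / 2))" .
  have "integrable lborel (\<lambda>y. h (a + \<sigma> * y))"
    unfolding h by (intro integrable_mult_right n_int)
  then show "integrable lborel h"
    using lborel_integrable_real_affine_iff[of \<sigma> h a] assms(1) by blast
  have "(LINT t|lborel. h t) = \<bar>\<sigma>\<bar> *\<^sub>R (LINT y|lborel. h (a + \<sigma> * y))"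
    using assms by (intro lborel_integral_real_affine) auto
  also have "(LINT y|lborel. h (a + \<sigma> * y)) = (of_real (sqrt (2 * pi)) * exp (- \<i> * of_real (a * x))) * exp (of_real (- \<sigma>\<^sup>2 * x\<^sup>2 / 2))"
    unfolding h n_eq[symmetric] by (rule Bochner_Integration.integral_mult_right_zero)
  finally show "(LINT t|lborel. h t) = of_real (sqrt (2 * pi) * \<sigma>) *
      (exp (- \<i> * of_real (a * x)) * exp (of_real (- \<sigma>\<^sup>2 * x\<^sup>2 / 2)))"
    using assms by (simp add: scaleR_conv_of_real)
qed

definition gaussian :: "real \<Rightarrow> real^'n::finite \<Rightarrow> real^'n \<Rightarrow> complex" where
  "gaussian \<sigma> a t = exp (of_real (- (norm (t - a))\<^sup>2 / (2 * \<sigma>\<^sup>2)))"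

lemma gaussian_fourier:
  fixes a x :: "real^'n::finite"
  assumes "\<sigma> > 0"
  shows "integrable lborel (\<lambda>t. exp (- \<i> * of_real (t \<bullet> x)) * gaussian \<sigma> a t)"
    and "fourier (gaussian \<sigma> a) x = of_real ((sqrt (2 * pi) * \<sigma>) ^ CARD('n)) *
      (exp (- \<i> * of_real (a \<bullet> x)) * exp (of_real (- \<sigma>\<^sup>2 * (norm x)\<^sup>2 / 2)))"
proof -
  let ?h = "\<lambda>b t. exp (- \<i> * of_real (t * (x \<bullet> b))) * exp (of_real (- (t - a \<bullet> b)\<^sup>2 / (2 * \<sigma>\<^sup>2)))"
  have fin: "finite (Basis :: (real^'n) set)" by simp
  have inner_sum: "p \<bullet> q = (\<Sum>b\<in>Basis. (p \<bullet> b) * (q \<bullet> b))" for p q :: "real^'n"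
    by (rule euclidean_inner)
  have nrm: "(norm p)\<^sup>2 = (\<Sum>b\<in>Basis. (p \<bullet> b)\<^sup>2)" for p :: "real^'n"
    unfolding power2_norm_eq_inner inner_sum[of p p] by (simp add: power2_eq_square)
  have wave: "exp (- \<i> * of_real (p \<bullet> x)) = (\<Prod>b\<in>Basis. exp (- \<i> * of_real ((p \<bullet> b) * (x \<bullet> b))))" for p
    unfolding inner_sum[of p x] by (simp add: exp_sum[OF fin, symmetric] sum_distrib_left sum_negf)
  have eq: "exp (- \<i> * of_real (t \<bullet> x)) * gaussian \<sigma> a t = (\<Prod>b\<in>Basis. ?h b (t \<bullet> b))" for t
  proof -
    have "- (norm (t - a))\<^sup>2 / (2 * \<sigma>\<^sup>2) = (\<Sum>b\<in>Basis. - (t \<bullet> b - a \<bullet> b)\<^sup>2 / (2 * \<sigma>\<^sup>2))"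
      unfolding nrm by (simp add: inner_diff_left sum_negf sum_divide_distrib)
    then have "gaussian \<sigma> a t = (\<Prod>b\<in>Basis. exp (of_real (- (t \<bullet> b - a \<bullet> b)\<^sup>2 / (2 * \<sigma>\<^sup>2))))"
      unfolding gaussian_def by (simp only: of_real_sum exp_sum[OF fin])
    then show ?thesis unfolding wave by (simp only: prod.distrib)
  qed
  show "integrable lborel (\<lambda>t. exp (- \<i> * of_real (t \<bullet> x)) * gaussian \<sigma> a t)"
    unfolding eq by (rule lborel_product_function(1)) (rule gaussian_fourier_1d(1)[OF assms])
  have "fourier (gaussian \<sigma> a) x = (\<Prod>b\<in>Basis. (LINT t|lborel. ?h b t))"
    unfolding fourier_def eq by (rule lborel_product_function(2)) (rule gaussian_fourier_1d(1)[OF assms])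
  also have "\<dots> = (\<Prod>b\<in>(Basis::(real^'n) set). of_real (sqrt (2 * pi) * \<sigma>)) *
     ((\<Prod>b\<in>Basis. exp (- \<i> * of_real ((a \<bullet> b) * (x \<bullet> b)))) * (\<Prod>b\<in>Basis. exp (of_real (- \<sigma>\<^sup>2 * (x \<bullet> b)\<^sup>2 / 2))))"
    unfolding gaussian_fourier_1d(2)[OF assms] by (simp only: prod.distrib)
  also have "(\<Prod>b\<in>(Basis::(real^'n) set). complex_of_real (sqrt (2 * pi) * \<sigma>)) = of_real ((sqrt (2 * pi) * \<sigma>) ^ CARD('n))"
    by simp
  also have "(\<Prod>b\<in>Basis. exp (- \<i> * of_real ((a \<bullet> b) * (x \<bullet> b)))) = exp (- \<i> * of_real (a \<bullet> x))"
    unfolding wave ..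
  also have "(\<Prod>b\<in>Basis. exp (complex_of_real (- \<sigma>\<^sup>2 * (x \<bullet> b)\<^sup>2 / 2))) = exp (of_real (- \<sigma>\<^sup>2 * (norm x)\<^sup>2 / 2))"
  proof -
    have "- \<sigma>\<^sup>2 * (norm x)\<^sup>2 / 2 = (\<Sum>b\<in>Basis. - \<sigma>\<^sup>2 * (x \<bullet> b)\<^sup>2 / 2)"
      unfolding nrm by (simp add: sum_negf sum_distrib_left sum_divide_distrib)
    then show ?thesis by (simp only: of_real_sum exp_sum[OF fin])
  qed
  finally show "fourier (gaussian \<sigma> a) x = of_real ((sqrt (2 * pi) * \<sigma>) ^ CARD('n)) *
      (exp (- \<i> * of_real (a \<bullet> x)) * exp (of_real (- \<sigma>\<^sup>2 * (norm x)\<^sup>2 / 2)))" .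
qed

lemma gaussian_integral:
  fixes a :: "real^'n::finite"
  assumes "\<sigma> > 0"
  shows "integrable lborel (gaussian \<sigma> a)"
    and "(LINT t|lborel. gaussian \<sigma> a t) = of_real ((sqrt (2 * pi) * \<sigma>) ^ CARD('n))"
  using gaussian_fourier[OF assms, where a = a and x = 0] by (simp_all add: fourier_def)

lemma norm_gaussian: "gaussian \<sigma> a t = of_real (norm (gaussian \<sigma> a t))"
  unfolding gaussian_def exp_of_real norm_of_real by simp

text \<open>
The exponent is a polynomial, and $|x|^2 \le 2|x-a|^2 + 2|a|^2$ gives the decay.
\<close>
lemma gaussian_schwartz:
  fixes a :: "real^'n::finite"
  assumes "\<sigma> > 0"
  shows "gaussian \<sigma> a \<in> schwartz_space"
proof -
  let ?q = "\<lambda>x. of_real (1 / \<sigma>\<^sup>2) * of_real (a \<bullet> x) + (of_real (- 1 / (2 * \<sigma>\<^sup>2)) * of_real ((norm x)\<^sup>2) + of_real (- (norm a)\<^sup>2 / (2 * \<sigma>\<^sup>2)))"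
  have q: "?q x = complex_of_real (- (norm (x - a))\<^sup>2 / (2 * \<sigma>\<^sup>2))" for x :: "real^'n"
  proof -
    have n: "(norm (x - a))\<^sup>2 = (norm x)\<^sup>2 - 2 * (a \<bullet> x) + (norm a)\<^sup>2"
      unfolding power2_norm_eq_inner by (simp add: inner_diff inner_commute)
    have "- (norm (x - a))\<^sup>2 / (2 * \<sigma>\<^sup>2) = 1 / \<sigma>\<^sup>2 * (a \<bullet> x) + (- 1 / (2 * \<sigma>\<^sup>2) * (norm x)\<^sup>2 + - (norm a)\<^sup>2 / (2 * \<sigma>\<^sup>2))"
      unfolding n using assms by (simp add: field_simps)
    then show ?thesis by simp
  qed
  have "(\<lambda>x. 1 * exp (?q x)) \<in> schwartz_space"
  proof (rule polynomial_exp_schwartz)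
    show "?q \<in> polynomial_funs"
      by (intro polynomial_funs_add polynomial_funs_mult polynomial_funs_const polynomial_funs_inner polynomial_funs_norm_square)
    show "0 < 1 / (4 * \<sigma>\<^sup>2)" using assms by simp
    fix x :: "real^'n"
    have "norm x \<le> norm (x - a) + norm a" by (metis diff_add_cancel norm_triangle_ineq)
    then have "(norm x)\<^sup>2 \<le> (norm (x - a) + norm a)\<^sup>2" by (intro power_mono) auto
    also have "\<dots> \<le> 2 * (norm (x - a))\<^sup>2 + 2 * (norm a)\<^sup>2"
      using sum_squares_bound[of "norm (x - a)" "norm a"] by (simp add: power2_sum)
    finally have "- (norm (x - a))\<^sup>2 / (2 * \<sigma>\<^sup>2) \<le> (norm a)\<^sup>2 / (2 * \<sigma>\<^sup>2) - 1 / (4 * \<sigma>\<^sup>2) * (norm x)\<^sup>2"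
      using assms by (simp add: field_simps)
    then show "Re (?q x) \<le> (norm a)\<^sup>2 / (2 * \<sigma>\<^sup>2) - 1 / (4 * \<sigma>\<^sup>2) * (norm x)\<^sup>2"
      unfolding q by simp
  qed (rule polynomial_funs_const)
  then show ?thesis unfolding q gaussian_def[abs_def] by simp
qed

lemma modulated_gaussian_schwartz:
  fixes t :: "real^'n::finite"
  assumes "\<sigma> > 0"
  shows "(\<lambda>x. exp (- \<i> * of_real (t \<bullet> x)) * exp (of_real (- \<sigma>\<^sup>2 * (norm x)\<^sup>2 / 2))) \<in> schwartz_space"
proof -
  let ?q = "\<lambda>x. - \<i> * of_real (t \<bullet> x) + of_real (- \<sigma>\<^sup>2 / 2) * of_real ((norm x)\<^sup>2)"
  have "(\<lambda>x. 1 * exp (?q x)) \<in> schwartz_space"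
  proof (rule polynomial_exp_schwartz)
    show "?q \<in> polynomial_funs"
      by (intro polynomial_funs_add polynomial_funs_mult polynomial_funs_const polynomial_funs_inner polynomial_funs_norm_square)
    show "0 < \<sigma>\<^sup>2 / 2" using assms by simp
    show "Re (?q x) \<le> 0 - \<sigma>\<^sup>2 / 2 * (norm x)\<^sup>2" for x by simp
  qed (rule polynomial_funs_const)
  also have "(\<lambda>x. 1 * exp (?q x)) = (\<lambda>x. exp (- \<i> * of_real (t \<bullet> x)) * exp (of_real (- \<sigma>\<^sup>2 * (norm x)\<^sup>2 / 2)))"
    by (simp flip: exp_add)
  finally show ?thesis .
qed

text \<open>
Convolution with the normal density of standard deviation \<open>\<sigma>\<close>. The Fourier
transform of this kernel is again a modulated Gaussian, an explicit Schwartz function to which a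
distribution can be applied.
\<close>
definition mollify :: "real \<Rightarrow> (real^'n::finite \<Rightarrow> complex) \<Rightarrow> real^'n \<Rightarrow> complex" where
  "mollify \<sigma> f t = (LINT y|lborel. f y * gaussian \<sigma> t y) / of_real ((sqrt (2 * pi) * \<sigma>) ^ CARD('n))"

lemma norm_mollify_le:
  fixes f :: "real^'n::finite \<Rightarrow> complex"
  assumes "\<sigma> > 0" and f: "f \<in> borel_measurable borel" and M: "\<And>t. norm (f t) \<le> M"
  shows "norm (mollify \<sigma> f t) \<le> M"
proof -
  let ?Z = "(sqrt (2 * pi) * \<sigma>) ^ CARD('n)"
  have Z: "?Z > 0" using assms by simp
  have g: "integrable lborel (\<lambda>y. norm (gaussian \<sigma> t y))"
    using gaussian_integral(1)[OF assms(1)] by (rule integrable_norm)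
  have "complex_of_real (LINT y|lborel. norm (gaussian \<sigma> t y)) = (LINT y|lborel. gaussian \<sigma> t y)"
    by (subst (2) norm_gaussian) (rule integral_complex_of_real[symmetric])
  also have "\<dots> = of_real ?Z" by (rule gaussian_integral(2)[OF assms(1)])
  finally have gZ: "(LINT y|lborel. norm (gaussian \<sigma> t y)) = ?Z" by (simp only: of_real_eq_iff)
  have "norm (LINT y|lborel. f y * gaussian \<sigma> t y) \<le> (LINT y|lborel. M * norm (gaussian \<sigma> t y))"
  proof (rule Bochner_Integration.integral_norm_bound_integral)
    have "M \<ge> 0" using M[of 0] norm_ge_zero order_trans by blast
    show Mg: "integrable lborel (\<lambda>y. M * norm (gaussian \<sigma> t y))" using g by (rule integrable_mult_right)
    show le: "norm (f y * gaussian \<sigma> t y) \<le> M * norm (gaussian \<sigma> t y)" for y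
      unfolding norm_mult using M by (intro mult_right_mono) auto
    have "gaussian \<sigma> t \<in> borel_measurable borel"
      using gaussian_integral(1)[OF assms(1), of t] by (simp add: borel_measurable_integrable)
    then have "(\<lambda>y. f y * gaussian \<sigma> t y) \<in> borel_measurable lborel" using f by simp
    then show "integrable lborel (\<lambda>y. f y * gaussian \<sigma> t y)"
      using Mg le \<open>M \<ge> 0\<close> by (intro Bochner_Integration.integrable_bound[OF Mg]) auto
  qed
  also have "\<dots> = M * ?Z" by (simp add: gZ)
  finally show ?thesis using Z unfolding mollify_def norm_divide norm_of_real by (simp add: field_simps)
qed

lemma mollify_tendsto:
  fixes f :: "real^'n::finite \<Rightarrow> complex"
  assumes f: "continuous_on UNIV f" and M: "\<And>t. norm (f t) \<le> M"
  shows "(\<lambda>k. mollify (1 / real (Suc k)) f t) \<longlonglongrightarrow> f t"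
proof -
  let ?Z = "(sqrt (2 * pi)) ^ CARD('n)"
  have [measurable]: "f \<in> borel_measurable borel" using f by (rule borel_measurable_continuous_onI)
  have g: "integrable lborel (gaussian 1 (0::real^'n))" by (rule gaussian_integral) simp
  then have [measurable]: "gaussian 1 (0::real^'n) \<in> borel_measurable borel"
    by (simp add: borel_measurable_integrable)
  have eq: "mollify \<sigma> f t = (LINT y|lborel. f (t + \<sigma> *\<^sub>R y) * gaussian 1 0 y) / of_real ?Z" if \<sigma>: "\<sigma> > 0" for \<sigma>
  proof -
    have [measurable]: "gaussian \<sigma> t \<in> borel_measurable borel"
      using gaussian_integral(1)[OF \<sigma>, of t] by (simp add: borel_measurable_integrable)
    have gs: "gaussian \<sigma> t (t + \<sigma> *\<^sub>R y) = gaussian 1 0 y" for y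
      using \<sigma> by (simp add: gaussian_def power_mult_distrib)
    have "(LINT y|lborel. f y * gaussian \<sigma> t y) =
      (LINT y|density (distr lborel borel (\<lambda>x. t + \<sigma> *\<^sub>R x)) (\<lambda>_. ennreal (\<bar>\<sigma>\<bar> ^ DIM(real^'n))). f y * gaussian \<sigma> t y)"
      using lborel_affine[of \<sigma> t] \<sigma> by simp
    also have "\<dots> = (LINT y|lborel. \<sigma> ^ CARD('n) *\<^sub>R (f (t + \<sigma> *\<^sub>R y) * gaussian \<sigma> t (t + \<sigma> *\<^sub>R y)))"
      using \<sigma> by (subst integral_density) (auto simp: integral_distr)
    also have "\<dots> = of_real (\<sigma> ^ CARD('n)) * (LINT y|lborel. f (t + \<sigma> *\<^sub>R y) * gaussian 1 0 y)"
      unfolding gs by (simp add: scaleR_conv_of_real)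
    finally show ?thesis using \<sigma> by (simp add: mollify_def power_mult_distrib)
  qed
  have "(\<lambda>k. LINT y|lborel. f (t + (1 / real (Suc k)) *\<^sub>R y) * gaussian 1 0 y) \<longlonglongrightarrow> (LINT y|lborel. f t * gaussian 1 (0::real^'n) y)"
  proof (rule integral_dominated_convergence[where w = "\<lambda>y::real^'n. M * norm (gaussian 1 0 y)"])
    show "integrable lborel (\<lambda>y::real^'n. M * norm (gaussian 1 0 y))" using g by (intro integrable_mult_right integrable_norm)
    show "AE y::real^'n in lborel. (\<lambda>k. f (t + (1 / real (Suc k)) *\<^sub>R y) * gaussian 1 0 y) \<longlonglongrightarrow> f t * gaussian 1 0 y"
    proof (intro AE_I2 tendsto_mult tendsto_const)
      fix y :: "real^'n"
      have "(\<lambda>k. t + (1 / real (Suc k)) *\<^sub>R y) \<longlonglongrightarrow> t + 0 *\<^sub>R y"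
        by (intro tendsto_intros LIMSEQ_Suc lim_1_over_n)
      moreover have "isCont f t" using f by (simp add: continuous_on_eq_continuous_at)
      ultimately show "(\<lambda>k. f (t + (1 / real (Suc k)) *\<^sub>R y)) \<longlonglongrightarrow> f t"
        by (intro isCont_tendsto_compose[of t f]) auto
    qed
    show "AE y::real^'n in lborel. norm (f (t + (1 / real (Suc k)) *\<^sub>R y) * gaussian 1 0 y) \<le> M * norm (gaussian 1 0 y)" for k
      unfolding norm_mult using M by (intro AE_I2 mult_right_mono) auto
  qed measurable
  moreover have "(LINT y|lborel. f t * gaussian 1 (0::real^'n) y) = f t * of_real ?Z"
    using gaussian_integral[of 1 "0::real^'n"] by simp
  ultimately have "(\<lambda>k. (LINT y|lborel. f (t + (1 / real (Suc k)) *\<^sub>R y) * gaussian 1 0 y) / of_real ?Z) \<longlonglongrightarrow> f t * of_real ?Z / of_real ?Z"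
    by (intro tendsto_divide tendsto_const) auto
  then show ?thesis using eq by simp
qed

section \<open>Sampling\<close>

text \<open>
On the line $\tau \mapsto t+\tau u$ the mollified function is $T$ applied to
$e^{-i\tau (u\cdot x)}\Phi(x)$ with a fixed Schwartz function $\Phi$. A weighted sum of its values is
therefore $T$ applied to a trigonometric sum times $\Phi$, and the sum with the interpolation weights
is small with all relevant derivatives on a strip around \<open>K\<close>. So the interpolation
inequality holds as it does for a function of exponential type $r < 1$.
\<close>
lemma mollified_directional_interpolation:
  fixes f :: "real^'n::finite \<Rightarrow> complex"
  assumes f: "f \<in> bernstein_space K" and M: "\<And>t. norm (f t) \<le> M" and "compact K"
    and u: "\<And>x. x \<in> K \<Longrightarrow> \<bar>u \<bullet> x\<bar> \<le> r" and r: "0 \<le> r" "r < 1"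
    and es: "0 < \<epsilon>" "0 < s" "s + \<epsilon> < pi" and "\<sigma> > 0"
  shows "norm (mollify \<sigma> f t) / sin \<epsilon> \<le> norm (mollify \<sigma> f (t + s *\<^sub>R u)) / sin (s + \<epsilon>) +
    M * (cos \<epsilon> / sin \<epsilon> - cos (s + \<epsilon>) / sin (s + \<epsilon>))"
proof -
  obtain T where T: "tempered_distribution T" "supported_by T K"
    and fT: "\<And>\<phi>. \<phi> \<in> schwartz_space \<Longrightarrow> (LINT t|lborel. f t * \<phi> t) = T (fourier \<phi>)"
    using f unfolding bernstein_space_def fourier_distribution_def by blast
  have fm: "f \<in> borel_measurable borel"
    using f by (auto simp: bernstein_space_def intro: borel_measurable_continuous_onI)
  let ?e = "\<lambda>t x. exp (- \<i> * of_real (t \<bullet> x))"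
  let ?\<Psi> = "\<lambda>x::real^'n. exp (complex_of_real (- \<sigma>\<^sup>2 * (norm x)\<^sup>2 / 2))"
  let ?Z = "complex_of_real ((sqrt (2 * pi) * \<sigma>) ^ CARD('n))"
  have Z: "?Z \<noteq> 0" using \<open>\<sigma> > 0\<close> by simp
  have sch: "(\<lambda>x. ?e t x * ?\<Psi> x) \<in> schwartz_space" for t
    using modulated_gaussian_schwartz[OF \<open>\<sigma> > 0\<close>] .
  have mol: "mollify \<sigma> f t = T (\<lambda>x. ?e t x * ?\<Psi> x)" for t
  proof -
    have "(LINT y|lborel. f y * gaussian \<sigma> t y) = T (fourier (gaussian \<sigma> t))"
      by (rule fT[OF gaussian_schwartz[OF \<open>\<sigma> > 0\<close>]])
    also have "fourier (gaussian \<sigma> t) = (\<lambda>x. ?Z * (?e t x * ?\<Psi> x))"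
      by (rule ext) (rule gaussian_fourier(2)[OF \<open>\<sigma> > 0\<close>])
    also have "T \<dots> = ?Z * T (\<lambda>x. ?e t x * ?\<Psi> x)"
      by (rule tempered_distribution_cmult[OF T(1) sch])
    finally show ?thesis using Z by (simp add: mollify_def)
  qed
  obtain N where N: "distribution_order T N" using tempered_distribution_order[OF T(1)] ..
  \<comment> \<open>The loss $N\delta$ of exponential type uses less than half of the room $1-r$.\<close>
  define \<delta> where "\<delta> = (1 - r) / (2 * (real N + 1))"
  define r' where "r' = 1 - real N * \<delta>"
  have \<delta>: "\<delta> > 0" using r by (simp add: \<delta>_def)
  have "real N * \<delta> \<le> (1 - r) / 2" using r by (simp add: \<delta>_def field_simps)
  then have r': "r < r'" using r by (simp add: r'_def)
  define \<Phi> where "\<Phi> = (\<lambda>x. ?e t x * ?\<Psi> x)"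
  have \<Phi>: "\<Phi> \<in> schwartz_space" unfolding \<Phi>_def by (rule sch)
  obtain B where B: "\<forall>A c \<eta>. finite A \<longrightarrow> 0 \<le> \<eta> \<longrightarrow>
    (\<forall>k \<xi>. k \<le> N \<longrightarrow> \<bar>\<xi>\<bar> \<le> r' \<longrightarrow>
      cmod (\<Sum>\<tau>\<in>A. c \<tau> * (- \<i> * of_real \<tau>) ^ k * exp (- \<i> * of_real (\<tau> * \<xi>))) \<le> \<eta>) \<longrightarrow>
    cmod (T (\<lambda>x. (\<Sum>\<tau>\<in>A. c \<tau> * exp (- \<i> * of_real (\<tau> * (u \<bullet> x)))) * \<Phi> x)) \<le> B * \<eta>"
    using distribution_trigonometric_bound[OF T N \<open>compact K\<close> u r(1) r' \<Phi>] ..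
  let ?A = "\<lambda>\<tau>. mollify \<sigma> f (t + \<tau> *\<^sub>R u)"
  have "norm (?A 0) / sin \<epsilon> \<le> norm (?A s) / sin (s + \<epsilon>) +
    M * (cos \<epsilon> / sin \<epsilon> - cos (s + \<epsilon>) / sin (s + \<epsilon>))"
  proof (rule approximate_interpolation_inequality[OF es])
    show "norm (?A \<tau>) \<le> M" for \<tau> by (rule norm_mollify_le[OF \<open>\<sigma> > 0\<close> fm M])
    fix P :: nat assume P: "P \<ge> 1"
    let ?N = "interp_nodes \<epsilon> s P"
    define c where "c = (\<lambda>\<tau>. of_real (interp_weight \<epsilon> s \<tau>) * csinc (of_real (\<delta> * \<tau>)) ^ N)"
    have fin: "finite ?N" by (simp add: interp_nodes_def)
    have "(\<Sum>\<tau>\<in>?N. c \<tau> * ?A \<tau>) = T (\<lambda>x. \<Sum>\<tau>\<in>?N. c \<tau> * (?e (t + \<tau> *\<^sub>R u) x * ?\<Psi> x))"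
      unfolding mol by (rule tempered_distribution_sum[OF T(1) fin sch, THEN conjunct2, symmetric])
    also have "(\<lambda>x. \<Sum>\<tau>\<in>?N. c \<tau> * (?e (t + \<tau> *\<^sub>R u) x * ?\<Psi> x)) =
      (\<lambda>x. (\<Sum>\<tau>\<in>?N. c \<tau> * exp (- \<i> * of_real (\<tau> * (u \<bullet> x)))) * \<Phi> x)"
    proof
      fix x
      have "?e (t + \<tau> *\<^sub>R u) x = exp (- \<i> * of_real (\<tau> * (u \<bullet> x))) * ?e t x" for \<tau>
        by (simp add: inner_add_left algebra_simps flip: exp_add)
      then show "(\<Sum>\<tau>\<in>?N. c \<tau> * (?e (t + \<tau> *\<^sub>R u) x * ?\<Psi> x)) =
        (\<Sum>\<tau>\<in>?N. c \<tau> * exp (- \<i> * of_real (\<tau> * (u \<bullet> x)))) * \<Phi> x"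
        unfolding \<Phi>_def sum_distrib_right by (simp only: mult.assoc)
    qed
    also have "norm (T \<dots>) \<le> B * (96 * s * (1 / \<delta> ^ N) / real P)"
    proof (rule B[rule_format, OF fin])
      show "0 \<le> 96 * s * (1 / \<delta> ^ N) / real P" using es \<delta> by simp
      fix k \<xi> assume "k \<le> N" "\<bar>\<xi>\<bar> \<le> r'"
      then show "norm (\<Sum>\<tau>\<in>?N. c \<tau> * (- \<i> * of_real \<tau>) ^ k * exp (- \<i> * of_real (\<tau> * \<xi>))) \<le> 96 * s * (1 / \<delta> ^ N) / real P"
        unfolding c_def using P by (intro decaying_exponential_interpolation_error[OF es \<delta>]) (auto simp: r'_def)
    qed
    finally show "norm (\<Sum>\<tau>\<in>?N. of_real (interp_weight \<epsilon> s \<tau>) * csinc (of_real (\<delta> * \<tau>)) ^ N * ?A \<tau>)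
      \<le> B * (96 * s * (1 / \<delta> ^ N)) / real P"
      by (simp add: c_def)
  qed
  then show ?thesis by simp
qed

text \<open>
A function bounded by \<open>M\<close> cannot fall faster along the line than $M\cos$ does:
$|f(t)| \ge M\cos\epsilon$ implies $|f(t+su)| \ge M\cos(s+\epsilon)$.
\<close>
lemma directional_interpolation:
  fixes f :: "real^'n::finite \<Rightarrow> complex"
  assumes f: "f \<in> bernstein_space K" and M: "\<And>t. norm (f t) \<le> M" and "compact K"
    and u: "\<And>x. x \<in> K \<Longrightarrow> \<bar>u \<bullet> x\<bar> \<le> r" and r: "0 \<le> r" "r < 1"
    and es: "0 < \<epsilon>" "0 < s" "s + \<epsilon> < pi"
  shows "norm (f t) / sin \<epsilon> \<le> norm (f (t + s *\<^sub>R u)) / sin (s + \<epsilon>) +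
    M * (cos \<epsilon> / sin \<epsilon> - cos (s + \<epsilon>) / sin (s + \<epsilon>))"
proof (rule LIMSEQ_le)
  have cont: "continuous_on UNIV f" using f by (simp add: bernstein_space_def)
  let ?m = "\<lambda>k. mollify (1 / real (Suc k)) f"
  show "(\<lambda>k. norm (?m k t) / sin \<epsilon>) \<longlonglongrightarrow> norm (f t) / sin \<epsilon>"
    by (intro tendsto_intros tendsto_divide tendsto_norm mollify_tendsto[OF cont M])
      (use sin_gt_zero[of \<epsilon>] es in auto)
  show "(\<lambda>k. norm (?m k (t + s *\<^sub>R u)) / sin (s + \<epsilon>) + M * (cos \<epsilon> / sin \<epsilon> - cos (s + \<epsilon>) / sin (s + \<epsilon>)))
     \<longlonglongrightarrow> norm (f (t + s *\<^sub>R u)) / sin (s + \<epsilon>) + M * (cos \<epsilon> / sin \<epsilon> - cos (s + \<epsilon>) / sin (s + \<epsilon>))"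
    by (intro tendsto_add tendsto_const tendsto_divide tendsto_norm mollify_tendsto[OF cont M])
      (use sin_gt_zero[of "s + \<epsilon>"] es in auto)
  show "\<exists>N. \<forall>k\<ge>N. norm (?m k t) / sin \<epsilon> \<le> norm (?m k (t + s *\<^sub>R u)) / sin (s + \<epsilon>) +
      M * (cos \<epsilon> / sin \<epsilon> - cos (s + \<epsilon>) / sin (s + \<epsilon>))"
    using mollified_directional_interpolation[OF f M \<open>compact K\<close> u r es] by simp
qed

text \<open>
A point \<open>t\<close> is joined to a sampling point \<open>l\<close> by $t = l+\rho x$ with
\<open>x\<close> in the polar body. In the direction $u = -(\rho/s)x$ with $s > \rho$ the set
\<open>K\<close> lies in the strip $|u\cdot y|\le\rho/s<1$, and $t+su=l$. Taking the supremum over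
\<open>t\<close> in the interpolation inequality, with \<open>M\<close> the supremum of
$|f|$, gives $M\cos\beta\le L$ for $\beta = s+\epsilon$, whether or not the supremum is attained. Then
$\beta$ tends to $\rho$.
\<close>
lemma bernstein_sup_le:
  fixes f :: "real^'n::finite \<Rightarrow> complex" and \<Lambda> :: "(real^'n) set"
  assumes K: "compact K" "\<forall>x\<in>K. - x \<in> K" and \<rho>: "0 < \<rho>" "\<rho> < pi / 2"
    and cover: "{l + \<rho> *\<^sub>R x | l x. l \<in> \<Lambda> \<and> x \<in> polar_body K} = UNIV"
    and f: "f \<in> bernstein_space K" and L: "\<And>l. l \<in> \<Lambda> \<Longrightarrow> norm (f l) \<le> L"
  shows "norm (f t) * cos \<rho> \<le> L"
proof -
  have "bounded (range f)" using f by (simp add: bernstein_space_def)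
  then have bdd: "bdd_above (range (\<lambda>t. norm (f t)))"
    by (metis bounded_imp_bdd_above bounded_norm_comp comp_apply image_cong)
  define M where "M = (SUP t. norm (f t))"
  have M: "norm (f t) \<le> M" for t unfolding M_def using bdd by (rule cSUP_upper2) auto
  have step: "M * cos \<beta> \<le> L" if \<beta>: "\<rho> < \<beta>" "\<beta> < pi / 2" for \<beta>
  proof -
    \<comment> \<open>Any splitting of \<open>\<beta>\<close> into $s > \rho$ and $\epsilon > 0$ would do.\<close>
    define s where "s = (\<rho> + \<beta>) / 2"
    define \<epsilon> where "\<epsilon> = \<beta> - s"
    have es: "0 < \<epsilon>" "0 < s" "s + \<epsilon> < pi" and s\<epsilon>: "s + \<epsilon> = \<beta>" and \<rho>s: "\<rho> < s"
      using \<rho> \<beta> by (auto simp: s_def \<epsilon>_def field_simps)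
    have sn: "sin \<epsilon> > 0" "sin \<beta> > 0" using es \<rho> \<beta> by (auto intro!: sin_gt_zero)
    have pt: "norm (f t) \<le> sin \<epsilon> * (L / sin \<beta> + M * (cos \<epsilon> / sin \<epsilon> - cos \<beta> / sin \<beta>))" for t
    proof -
      have "t \<in> {l + \<rho> *\<^sub>R x | l x. l \<in> \<Lambda> \<and> x \<in> polar_body K}" unfolding cover by simp
      then obtain l x where lx: "t = l + \<rho> *\<^sub>R x" "l \<in> \<Lambda>" "x \<in> polar_body K" by blast
      let ?u = "- (\<rho> / s) *\<^sub>R x"
      have "\<bar>?u \<bullet> y\<bar> \<le> \<rho> / s" if "y \<in> K" for y
      proof -
        have "x \<bullet> y \<le> 1" "x \<bullet> (- y) \<le> 1" using lx(3) K(2) that unfolding polar_body_def by blast+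
        then have "\<bar>x \<bullet> y\<bar> \<le> 1" by simp
        then show ?thesis using \<rho> es by (simp add: abs_mult abs_divide divide_right_mono mult_left_le)
      qed
      then have "norm (f t) / sin \<epsilon> \<le> norm (f (t + s *\<^sub>R ?u)) / sin (s + \<epsilon>) + M * (cos \<epsilon> / sin \<epsilon> - cos (s + \<epsilon>) / sin (s + \<epsilon>))"
        using \<rho> \<rho>s es by (intro directional_interpolation[OF f M K(1), of ?u "\<rho> / s"]) auto
      moreover have "t + s *\<^sub>R ?u = l" using es by (simp add: lx(1))
      moreover have "norm (f l) / sin \<beta> \<le> L / sin \<beta>" using L[OF lx(2)] sn by (simp add: divide_right_mono)
      ultimately have "norm (f t) / sin \<epsilon> \<le> L / sin \<beta> + M * (cos \<epsilon> / sin \<epsilon> - cos \<beta> / sin \<beta>)"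
        unfolding s\<epsilon> by simp
      then show ?thesis using sn by (simp add: pos_divide_le_eq mult.commute)
    qed
    have "M \<le> sin \<epsilon> * (L / sin \<beta> + M * (cos \<epsilon> / sin \<epsilon> - cos \<beta> / sin \<beta>))"
      unfolding M_def by (rule cSUP_least) (use pt in \<open>auto simp: M_def\<close>)
    also have "\<dots> = sin \<epsilon> * ((L - M * cos \<beta>) / sin \<beta>) + M * cos \<epsilon>"
      using sn by (simp add: field_simps)
    finally have "M * (1 - cos \<epsilon>) \<le> sin \<epsilon> * ((L - M * cos \<beta>) / sin \<beta>)"
      by (simp add: algebra_simps)
    moreover have "0 \<le> M * (1 - cos \<epsilon>)"
      using order_trans[OF norm_ge_zero M[of 0]] by (intro mult_nonneg_nonneg) auto
    ultimately have "0 \<le> sin \<epsilon> * ((L - M * cos \<beta>) / sin \<beta>)" by linarith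
    then have "0 \<le> L - M * cos \<beta>" using sn by (simp add: zero_le_mult_iff zero_le_divide_iff)
    then show ?thesis by simp
  qed
  have "((\<lambda>\<beta>. M * cos \<beta>) \<longlongrightarrow> M * cos \<rho>) (at_right \<rho>)"
    by (intro tendsto_intros)
  moreover have "\<forall>\<^sub>F \<beta> in at_right \<rho>. M * cos \<beta> \<le> L"
    using \<rho> step by (intro eventually_at_rightI[of \<rho> "pi / 2"]) auto
  ultimately have "M * cos \<rho> \<le> L"
    by (rule tendsto_upperbound) simp
  moreover have "norm (f t) * cos \<rho> \<le> M * cos \<rho>"
    using M \<rho> by (intro mult_right_mono) (auto intro: cos_ge_zero)
  ultimately show ?thesis by linarith
qed

theorem theorem4p1:
  fixes K \<Lambda> :: "(real^'n::finite) set" and \<rho> :: real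
  assumes "CARD('n) > 1"
    and "compact K" and "convex K" and "\<forall>x\<in>K. - x \<in> K" and "measure lebesgue K > 0"
    and "0 < \<rho>" and "\<rho> < pi / 2"
    and "{l + \<rho> *\<^sub>R x | l x. l \<in> \<Lambda> \<and> x \<in> polar_body K} = UNIV"
  shows "(\<forall>f\<in>bernstein_space K.
            (SUP t. ennreal (cmod (f t)))
              \<le> ennreal (1 / cos \<rho>) * (SUP l\<in>\<Lambda>. ennreal (cmod (f l))))
         \<and> stable_sampling_set \<Lambda> K"
proof -
  have cos: "cos \<rho> > 0" using assms by (intro cos_gt_zero_pi) auto
  have main: "(SUP t. ennreal (cmod (f t))) \<le> ennreal (1 / cos \<rho>) * (SUP l\<in>\<Lambda>. ennreal (cmod (f l)))"
    if f: "f \<in> bernstein_space K" for f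
  proof -
    obtain C where C: "\<And>t. cmod (f t) \<le> C"
      using f by (auto simp: bernstein_space_def bounded_iff)
    let ?S = "SUP l\<in>\<Lambda>. ennreal (cmod (f l))"
    define L where "L = enn2real ?S"
    have "?S \<le> ennreal C" using C by (intro SUP_least ennreal_leI)
    then have "?S < top" by (rule le_less_trans) simp
    then have SUP: "?S = ennreal L" by (simp add: L_def)
    have "L \<ge> 0" by (simp add: L_def)
    have L: "cmod (f l) \<le> L" if "l \<in> \<Lambda>" for l
    proof -
      have "ennreal (cmod (f l)) \<le> ?S" using that by (rule SUP_upper)
      then show ?thesis unfolding SUP using \<open>L \<ge> 0\<close> by simp
    qed
    have "ennreal (cmod (f t)) \<le> ennreal (1 / cos \<rho>) * ennreal L" for t
    proof -
      have "cmod (f t) * cos \<rho> \<le> L"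
        using assms f L by (intro bernstein_sup_le[of K \<rho> \<Lambda>]) auto
      then have "cmod (f t) \<le> 1 / cos \<rho> * L" using cos by (simp add: field_simps)
      then show ?thesis using cos \<open>L \<ge> 0\<close> by (simp add: ennreal_leI flip: ennreal_mult')
    qed
    then show ?thesis unfolding SUP by (intro SUP_least)
  qed
  then show ?thesis unfolding stable_sampling_set_def by blast
qed

end
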